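(* Let $n\ge m\ge 2$ be integers, and write $n-m=q(m+1)-r$, where $q$ and $r$ are integers with $0\le r\le m$. Then the zero blocking number of the grid graph $G_{m,n}$ satisfies $$B(G_{m,n})=n-q+\lceil r/2\rceil \quad\text{if } r\le 2q,$$ and $$B(G_{m,n})=n-q+m-1 \quad\text{if } r>2q.$$
   Context: Zero forcing process on a finite graph $G$: the vertex set is initially partitioned into a set $\mathcal{B}$ of black vertices and a set $\mathcal{W}$ of white vertices. Whenever there is a black vertex adjacent to exactly one white vertex, that white vertex is forced to become black; this is repeated as long as possible. If ultimately all vertices are black, $\mathcal{B}$ is a zero forcing set; otherwise (some vertex stays white forever) the initial white set $\mathcal{W}$ is called a zero blocking set. The zero blocking number $B(G)$ is the minimum size of a zero blocking set of $G$. Grid graph: for integers $m,n\ge 1$, $G_{m,n}=P_m\Box P_n$ is the graph with vertex set $\{(i,j):1\le i\le n,\ 1\le j\le m\}$ (integers $i,j$), where $(x,y)$ is adjacent to $(x',y')$ iff $|x-x'|+|y-y'|=1$. *)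

theory Defs
  imports Complex_Main "Graph_Theory.Pair_Digraph"
begin

text \<open>Simple graphs are symmetric loop-free pair digraphs (\<open>pair_graph\<close>): an undirected edge is
  a pair of opposite arcs. A coloring is given by its set of black vertices.\<close>

definition force_step :: "'a pair_pre_digraph \<Rightarrow> 'a set \<Rightarrow> 'a set \<Rightarrow> bool" where
  "force_step G B B' \<longleftrightarrow>
     (\<exists>u\<in>B. \<exists>w. {v \<in> pverts G - B. (u, v) \<in> parcs G} = {w} \<and> B' = insert w B)"

text \<open>The final coloring does not depend on the order of the forces, see
  \<open>zero_forcing_set_iff_final\<close> below, so it suffices that some sequence of forces blackens
  all vertices.\<close>

definition zero_forcing_set :: "'a pair_pre_digraph \<Rightarrow> 'a set \<Rightarrow> bool" where
  "zero_forcing_set G B \<longleftrightarrow> B \<subseteq> pverts G \<and> (force_step G)\<^sup>*\<^sup>* B (pverts G)"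

definition zero_blocking_set :: "'a pair_pre_digraph \<Rightarrow> 'a set \<Rightarrow> bool" where
  "zero_blocking_set G W \<longleftrightarrow> W \<subseteq> pverts G \<and> \<not> zero_forcing_set G (pverts G - W)"

definition zero_blocking_number :: "'a pair_pre_digraph \<Rightarrow> nat" where
  "zero_blocking_number G = (LEAST k. \<exists>W. zero_blocking_set G W \<and> card W = k)"

definition grid_vertices :: "int \<Rightarrow> int \<Rightarrow> (int \<times> int) set" where
  "grid_vertices m n = {(i, j). 1 \<le> i \<and> i \<le> n \<and> 1 \<le> j \<and> j \<le> m}"

definition grid_graph :: "int \<Rightarrow> int \<Rightarrow> (int \<times> int) pair_pre_digraph" where
  "grid_graph m n =
     \<lparr> pverts = grid_vertices m n,
       parcs = {((x, y), (x', y')). (x, y) \<in> grid_vertices m n \<and> (x', y') \<in> grid_vertices m n \<and>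
                  \<bar>x - x'\<bar> + \<bar>y - y'\<bar> = 1} \<rparr>"

lemma force_steps_subset_stalled:
  assumes "(force_step G)\<^sup>*\<^sup>* B C" "B \<subseteq> D" "\<nexists>D'. force_step G D D'"
  shows "C \<subseteq> D"
  using assms(1)
proof (induction rule: rtranclp_induct)
  case base
  then show ?case using assms(2) .
next
  case (step C C')
  from step.hyps(2) obtain u w where u: "u \<in> C"
    and w: "{v \<in> pverts G - C. (u, v) \<in> parcs G} = {w}" and C': "C' = insert w C"
    unfolding force_step_def by blast
  have "w \<in> D"
  proof (rule ccontr)
    assume "w \<notin> D"
    with w step.IH have "{v \<in> pverts G - D. (u, v) \<in> parcs G} = {w}" by blast
    then have "force_step G D (insert w D)"
      using u step.IH unfolding force_step_def by blast
    with assms(3) show False by blast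
  qed
  with step.IH C' show ?case by blast
qed

lemma force_steps_subset_verts:
  assumes "(force_step G)\<^sup>*\<^sup>* B C" "B \<subseteq> pverts G"
  shows "C \<subseteq> pverts G"
  using assms by (induction rule: rtranclp_induct) (auto simp: force_step_def)

lemma zero_forcing_set_iff_final:
  assumes "B \<subseteq> pverts G" "(force_step G)\<^sup>*\<^sup>* B C" "\<nexists>C'. force_step G C C'"
  shows "zero_forcing_set G B \<longleftrightarrow> C = pverts G"
proof
  have BC: "B \<subseteq> C"
    using assms(2) by (induction rule: rtranclp_induct) (auto simp: force_step_def)
  assume "zero_forcing_set G B"
  then have "pverts G \<subseteq> C"
    using force_steps_subset_stalled[OF _ BC assms(3)] unfolding zero_forcing_set_def by blast
  then show "C = pverts G"
    using force_steps_subset_verts[OF assms(2,1)] by blast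
next
  assume "C = pverts G"
  then show "zero_forcing_set G B"
    using assms(1,2) by (simp add: zero_forcing_set_def)
qed

lemma zero_blocking_set_verts:
  assumes "pverts G \<noteq> {}"
  shows "zero_blocking_set G (pverts G)"
proof -
  have "\<nexists>C. force_step G {} C" by (simp add: force_step_def)
  then show ?thesis
    using assms zero_forcing_set_iff_final[of "{}" G "{}"] by (auto simp: zero_blocking_set_def)
qed

lemma finite_grid_vertices: "finite (grid_vertices m n)"
  by (rule finite_subset[of _ "{1..n} \<times> {1..m}"]) (auto simp: grid_vertices_def)

lemma pair_graph_grid_graph: "pair_graph (grid_graph m n)"
proof
  show "finite (parcs (grid_graph m n))"
    by (rule finite_subset[of _ "grid_vertices m n \<times> grid_vertices m n"])
       (auto simp: grid_graph_def finite_grid_vertices)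
  show "symmetric (grid_graph m n)"
    by (auto simp: symmetric_def grid_graph_def abs_minus_commute intro!: symI)
qed (auto simp: grid_graph_def finite_grid_vertices)

end

theory Submission
  imports Defs
begin

text \<open>
  A set of white vertices is never changed by the forcing process iff no black vertex has exactly
  one white neighbour. Such a stalled set is called a \<open>fort\<close> below. Every zero blocking set
  contains a nonempty fort and every nonempty fort is zero blocking, so the zero blocking number is
  the least size of a nonempty fort.

  \<^bold>\<open>Why the number is what it is.\<close> Column \<open>i\<close> of the grid consists of the vertices \<open>(i, j)\<close>.
  The cheapest fort is a single diagonal strand: a white vertex that moves up by one row per column,
  is reflected at the top, moves down, and so on; it must start and end in corners.
  There are three ways to be reflected at a wall: the strand turns back at once, so that two
  diagonal segments share a column; it stays at the wall for two columns; or it leaves an empty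
  column between two visits of the wall. A strand with \<open>q\<close> reflections has \<open>q + 1\<close> segments of \<open>m\<close>
  columns each, to which the three kinds of reflection contribute \<open>-1\<close>, \<open>0\<close> and \<open>1\<close> columns,
  respectively. Only an empty column keeps the fort smaller than the number of columns. The grid has
  \<open>r\<close> columns less than \<open>q\<close> empty columns would need, and replacing an empty column by a shared
  one gains two, so \<open>\<lceil>r/2\<rceil>\<close> empty columns have to be given up; this is possible iff
  \<open>r \<le> 2 q\<close>. If \<open>r > 2 q\<close>, a single strand cannot end in a corner. It must fork, and
  the two branches bound a tilted rectangle that touches the top, the bottom and the right wall. Such a
  rectangle has as many columns as there are rows, so it costs \<open>m - 2\<close> further vertices and one
  of the \<open>q\<close> empty columns.

  \<^bold>\<open>The lower bound.\<close> The columns on both sides of an empty column are equal, so an empty column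
  acts like a wall: a fort is cut by its empty columns into \<^emph>\<open>pieces\<close>, which are forts without empty
  columns. The \<^emph>\<open>excess\<close> of a piece is the number of its vertices minus its width.
  The core of the proof is a classification of pieces (\<open>piece_dichotomy\<close>). A piece of excess \<open>0\<close>
  is a zigzag whose width \<open>w\<close> satisfies \<open>k (m - 1) < w \<le> k m\<close> for some \<open>k\<close>. Every other piece
  has excess at least \<open>(m - 1) / 2\<close>, and at least \<open>m - 2\<close> if it is at least as wide as high and
  its width is not that of a zigzag. From this, \<open>fort_summary\<close> collects what several pieces in a row
  can do, and \<open>summary_target\<close> is the resulting arithmetic.

  For wide pieces the classification rests on the topmost white vertex \<open>front W i\<close> of column \<open>i\<close>.
  Below the top row it is exceeded by the front of a neighbouring column, by one only,
  unless the front of the opposite neighbour is as high (\<open>front_grow\<close>, \<open>front_step\<close>). Hence a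
  front that starts from a single white vertex has to climb to the top wall, and come back before the
  next column that consists of just one strand, at speed one, and the same holds upside
  down for the lowest white vertex. Adding the two requirements gives \<open>m - 1\<close>
  steps (\<open>profile_bound\<close>, \<open>interval_jumps\<close>). The columns in between contain at least two white
  vertices, except for columns over which one of the fronts jumps, and each of these
  lengthens the way by at least one column. If the region with two strands extends to the end of the
  piece, and that piece does not have the width of a zigzag, the missing part of the rectangle is
  made up for by strands that fan out from the last column (\<open>end_fan\<close>).
  For pieces narrower than \<open>m\<close> the classification is the theorem itself for the transposed
  grid, so that the lower bound is an induction on \<open>m\<close>.
\<close>

section \<open>Integer profiles that climb to a ceiling\<close>

text \<open>\<open>M\<close> models the fronts of consecutive columns. A value below the ceiling \<open>m\<close> is exceeded on one side,
  so after a first step from \<open>a\<close>, which may be flat, the profile climbs by exactly one per step to its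
  first visit \<open>z\<close> of the ceiling. After that it may jump into a valley and out of it again, but the smoothed profile
  \<open>N i = max (M i) (M (i + 1) - 1)\<close> changes by at most one per step, so every step upwards
  is paid for by a step downwards. This gives the quantitative bound, in which upward steps
  count twice.\<close>

lemma profile_bound:
  fixes M :: "int \<Rightarrow> int"
  assumes ab: "a < b"
    and up: "\<And>i. a < i \<Longrightarrow> i < b \<Longrightarrow> M (i+1) \<le> max (M i + 1) (M (i-1))"
    and dn: "\<And>i. a < i \<Longrightarrow> i < b \<Longrightarrow> M (i-1) \<le> max (M i + 1) (M (i+1))"
    and grow: "\<And>i. a < i \<Longrightarrow> i < b \<Longrightarrow> M i < m \<Longrightarrow> M i < M (i-1) \<or> M i < M (i+1)"
    and le: "\<And>i. a \<le> i \<Longrightarrow> i \<le> b \<Longrightarrow> M i \<le> m"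
    and a1: "M (a+1) \<le> M a + 1" and a2: "M a \<le> M (a+1) \<or> M a = m"
    and b1: "M (b-1) \<le> M b + 1" and b2: "M b \<le> M (b-1) \<or> M b = m"
    and nd: "a + 2 \<le> b \<or> M a \<noteq> M b \<or> M a = m"
  obtains z where "a \<le> z" "z \<le> b" "M z = m" "\<And>i. a \<le> i \<Longrightarrow> i < z \<Longrightarrow> M i < m"
    "\<And>i. a < i \<Longrightarrow> i < z \<Longrightarrow> M (i+1) = M i + 1"
    "\<And>i. a \<le> i \<Longrightarrow> i < z \<Longrightarrow> M i \<le> M (i+1)"
    "\<And>i. a \<le> i \<Longrightarrow> i \<le> z \<Longrightarrow> m - (z - i) \<le> M i"
    "2 * int (card {i. z \<le> i \<and> i < b \<and> M i < M (i+1)}) + (m - M a) + (m - M b) \<le> b - a"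
proof -
  \<comment> \<open>As long as the ceiling has not been reached, a profile that does not descend keeps climbing.\<close>
  have rise: "M i \<le> M (i+1) \<and> M (i+1) \<le> M i + 1 \<and> (a < i \<longrightarrow> M (i+1) = M i + 1)"
    if c: "c \<le> b" and below: "\<And>i. a \<le> i \<Longrightarrow> i < c \<Longrightarrow> M i < m" and i: "a \<le> i" "i < c" for c i
    using i
  proof (induction i rule: int_ge_induct)
    case base
    then show ?case using a1 a2 below[of a] by force
  next
    case (step i)
    then have IH: "M i \<le> M (i+1)" by auto
    have "M (i+1) < m" using below[of "i+1"] step by auto
    with IH up[of "i+1"] grow[of "i+1"] step c show ?case by fastforce
  qed
  have ex: "\<exists>z. a \<le> z \<and> z \<le> b \<and> M z = m"
  proof (rule ccontr)
    assume none: "\<not> ?thesis"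
    have lt: "M i < m" if "a \<le> i" "i \<le> b" for i
      using none le[OF that] that by force
    have r: "M i \<le> M (i+1)" "a < i \<longrightarrow> M (i+1) = M i + 1" if "a \<le> i" "i < b" for i
      using rise[of b i] lt that by auto
    show False
    proof (cases "a + 2 \<le> b")
      case True
      then show False using r[of "b-1"] b2 lt[of b] by auto
    next
      case False
      then have "b = a + 1" using ab by auto
      then show False using r[of a] b2 lt[of a] lt[of b] nd by auto
    qed
  qed
  define z where "z = Min {z \<in> {a..b}. M z = m}"
  have fin: "finite {z \<in> {a..b}. M z = m}" by (rule finite_subset[of _ "{a..b}"]) auto
  have "{z \<in> {a..b}. M z = m} \<noteq> {}" using ex by auto
  then have "z \<in> {z \<in> {a..b}. M z = m}" unfolding z_def using Min_in[OF fin] by blast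
  then have z: "a \<le> z" "z \<le> b" "M z = m" by auto
  have first: "M i < m" if "a \<le> i" "i < z" for i
  proof (rule ccontr)
    assume "\<not> M i < m"
    then have "i \<in> {z \<in> {a..b}. M z = m}" using le[of i] that z by auto
    then have "z \<le> i" unfolding z_def using Min_le[OF fin] by blast
    then show False using that by simp
  qed
  have r: "M i \<le> M (i+1)" "M (i+1) \<le> M i + 1" "a < i \<Longrightarrow> M (i+1) = M i + 1" if "a \<le> i" "i < z" for i
    using rise[of z i] first that z by auto
  have slope: "m - (z - i) \<le> M i" if "i \<le> z" "a \<le> i" for i
    using that
  proof (induction i rule: int_le_induct)
    case base then show ?case using z by simp
  next
    case (step i)
    then show ?case using r(2)[of "i-1"] by auto
  qed
  \<comment> \<open>A jump from \<open>i\<close> to \<open>i + 1\<close> leads back to the height at \<open>i - 1\<close>; \<open>N\<close> replaces the hole by a valley of depth one.\<close>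
  define N where "N i = (if i < b then max (M i) (M (i+1) - 1) else M i)" for i
  have Nz: "N z = m" using z le[of "z+1"] unfolding N_def by auto
  have lip: "N (i+1) \<le> N i + 1 \<and> N i \<le> N (i+1) + 1" if "a \<le> i" "i < b" for i
  proof (cases "i + 1 < b")
    case True
    then have "M (i+2) \<le> max (M (i+1) + 1) (M i)" "M i \<le> max (M (i+1) + 1) (M (i+2))"
      using up[of "i+1"] dn[of "i+1"] that by (auto simp: algebra_simps)
    then show ?thesis using True unfolding N_def by (auto simp: algebra_simps)
  next
    case False
    then have "i = b - 1" using that by auto
    then show ?thesis using b1 unfolding N_def by auto
  qed
  have upN: "N i < N (i+1)" if "i < b" "M i < M (i+1)" for i
    using that unfolding N_def by auto
  have walk: "2 * int (card {k. z \<le> k \<and> k < i \<and> M k < M (k+1)}) + (m - N i) \<le> i - z"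
    if "z \<le> i" "i \<le> b" for i
    using that
  proof (induction i rule: int_ge_induct)
    case base
    then show ?case using Nz by (auto intro: card_eq_0_iff[THEN iffD2])
  next
    case (step i)
    let ?U = "\<lambda>i. {k. z \<le> k \<and> k < i \<and> M k < M (k+1)}"
    have finU: "finite (?U i)" by (rule finite_subset[of _ "{z..i}"]) auto
    show ?case
    proof (cases "M i < M (i+1)")
      case True
      then have "?U (i+1) = insert i (?U i)" using step by auto
      then have "card (?U (i+1)) = Suc (card (?U i))" using finU by simp
      moreover have "N (i+1) = N i + 1" using upN[of i] lip[of i] True step z by auto
      ultimately show ?thesis using step by auto
    next
      case False
      then have "k < i + 1 \<and> M k < M (k+1) \<longleftrightarrow> k < i \<and> M k < M (k+1)" for k
        by (cases "k = i") auto
      then have "?U (i+1) = ?U i" by simp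
      moreover have "N i \<le> N (i+1) + 1" using step lip[of i] z by auto
      ultimately show ?thesis using step by auto
    qed
  qed
  have "N b = M b" by (simp add: N_def)
  then have "2 * int (card {i. z \<le> i \<and> i < b \<and> M i < M (i+1)}) + (m - M b) \<le> b - z"
    using walk[of b] z by auto
  moreover have "m - M a \<le> z - a" using slope[of a] z by auto
  ultimately have "2 * int (card {i. z \<le> i \<and> i < b \<and> M i < M (i+1)}) + (m - M a) + (m - M b) \<le> b - a"
    by linarith
  note bound = this
  show thesis
    by (rule that[OF z _ _ _ _ bound]) (use first r slope in auto)
qed

section \<open>Forts and their symmetries\<close>

text \<open>The columns range over \<open>{a..b}\<close> with an arbitrary start \<open>a\<close>, since pieces of a fort are forts again.
  The condition on black vertices says that the number of white neighbours is not one, in a form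
  that is invariant under the symmetries of the grid. The empty set is included.\<close>

definition fort :: "int \<Rightarrow> int \<Rightarrow> int \<Rightarrow> (int \<times> int) set \<Rightarrow> bool" where
  "fort m a b W \<longleftrightarrow> W \<subseteq> {a..b} \<times> {1..m} \<and>
     (\<forall>i j. a \<le> i \<and> i \<le> b \<and> 1 \<le> j \<and> j \<le> m \<and> (i, j) \<notin> W \<longrightarrow>
        (\<forall>x y. (x, y) \<in> W \<and> \<bar>x - i\<bar> + \<bar>y - j\<bar> = 1 \<longrightarrow>
           (\<exists>x' y'. (x', y') \<in> W \<and> \<bar>x' - i\<bar> + \<bar>y' - j\<bar> = 1 \<and> (x', y') \<noteq> (x, y))))"

definition col :: "(int \<times> int) set \<Rightarrow> int \<Rightarrow> int set" where
  "col W i = {j. (i, j) \<in> W}"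

lemma in_col [simp]: "j \<in> col W i \<longleftrightarrow> (i, j) \<in> W"
  by (simp add: col_def)

lemma unit_step_cases:
  fixes x y i j :: int
  assumes "\<bar>x - i\<bar> + \<bar>y - j\<bar> = 1"
  shows "(x = i - 1 \<and> y = j) \<or> (x = i + 1 \<and> y = j) \<or> (x = i \<and> y = j - 1) \<or> (x = i \<and> y = j + 1)"
  using assms by linarith

lemma fort_grid:
  assumes "fort m a b W" "(i, j) \<in> W"
  shows "a \<le> i" "i \<le> b" "1 \<le> j" "j \<le> m"
  using assms unfolding fort_def by auto

lemma fort_other:
  assumes "fort m a b W" "a \<le> i" "i \<le> b" "1 \<le> j" "j \<le> m" "(i, j) \<notin> W"
  shows fort_left: "(i - 1, j) \<in> W \<Longrightarrow> (i + 1, j) \<in> W \<or> (i, j - 1) \<in> W \<or> (i, j + 1) \<in> W"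
    and fort_right: "(i + 1, j) \<in> W \<Longrightarrow> (i - 1, j) \<in> W \<or> (i, j - 1) \<in> W \<or> (i, j + 1) \<in> W"
    and fort_down: "(i, j - 1) \<in> W \<Longrightarrow> (i - 1, j) \<in> W \<or> (i + 1, j) \<in> W \<or> (i, j + 1) \<in> W"
    and fort_up: "(i, j + 1) \<in> W \<Longrightarrow> (i - 1, j) \<in> W \<or> (i + 1, j) \<in> W \<or> (i, j - 1) \<in> W"
proof -
  have *: "\<exists>x' y'. (x', y') \<in> W \<and> \<bar>x' - i\<bar> + \<bar>y' - j\<bar> = 1 \<and> (x', y') \<noteq> (x, y)"
    if "(x, y) \<in> W" "\<bar>x - i\<bar> + \<bar>y - j\<bar> = 1" for x y
    using assms that unfolding fort_def by blast
  show "(i - 1, j) \<in> W \<Longrightarrow> (i + 1, j) \<in> W \<or> (i, j - 1) \<in> W \<or> (i, j + 1) \<in> W"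
    using *[of "i - 1" j] unit_step_cases by fastforce
  show "(i + 1, j) \<in> W \<Longrightarrow> (i - 1, j) \<in> W \<or> (i, j - 1) \<in> W \<or> (i, j + 1) \<in> W"
    using *[of "i + 1" j] unit_step_cases by fastforce
  show "(i, j - 1) \<in> W \<Longrightarrow> (i - 1, j) \<in> W \<or> (i + 1, j) \<in> W \<or> (i, j + 1) \<in> W"
    using *[of "i" "j - 1"] unit_step_cases by fastforce
  show "(i, j + 1) \<in> W \<Longrightarrow> (i - 1, j) \<in> W \<or> (i + 1, j) \<in> W \<or> (i, j - 1) \<in> W"
    using *[of "i" "j + 1"] unit_step_cases by fastforce
qed

text \<open>The same condition at a black vertex, spelled out for the four directions.\<close>

definition balanced :: "(int \<times> int) set \<Rightarrow> int \<Rightarrow> int \<Rightarrow> bool" where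
  "balanced W i j \<longleftrightarrow>
     ((i - 1, j) \<in> W \<longrightarrow> (i + 1, j) \<in> W \<or> (i, j - 1) \<in> W \<or> (i, j + 1) \<in> W) \<and>
     ((i + 1, j) \<in> W \<longrightarrow> (i - 1, j) \<in> W \<or> (i, j - 1) \<in> W \<or> (i, j + 1) \<in> W) \<and>
     ((i, j - 1) \<in> W \<longrightarrow> (i - 1, j) \<in> W \<or> (i + 1, j) \<in> W \<or> (i, j + 1) \<in> W) \<and>
     ((i, j + 1) \<in> W \<longrightarrow> (i - 1, j) \<in> W \<or> (i + 1, j) \<in> W \<or> (i, j - 1) \<in> W)"

lemma fortI:
  assumes "W \<subseteq> {a..b} \<times> {1..m}"
    and "\<And>i j. a \<le> i \<Longrightarrow> i \<le> b \<Longrightarrow> 1 \<le> j \<Longrightarrow> j \<le> m \<Longrightarrow> (i, j) \<notin> W \<Longrightarrow> balanced W i j"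
  shows "fort m a b W"
  unfolding fort_def
proof (intro conjI allI impI)
  show "W \<subseteq> {a..b} \<times> {1..m}" by (fact assms(1))
next
  fix i j x y
  assume ij: "a \<le> i \<and> i \<le> b \<and> 1 \<le> j \<and> j \<le> m \<and> (i, j) \<notin> W"
    and xy: "(x, y) \<in> W \<and> \<bar>x - i\<bar> + \<bar>y - j\<bar> = 1"
  have w: "\<exists>x' y'. (x', y') \<in> W \<and> \<bar>x' - i\<bar> + \<bar>y' - j\<bar> = 1 \<and> (x', y') \<noteq> (x, y)"
    if "(u, v) \<in> W" "\<bar>u - i\<bar> + \<bar>v - j\<bar> = 1" "(u, v) \<noteq> (x, y)" for u v
    using that by blast
  from unit_step_cases[of x i y j] xy
  consider "x = i - 1" "y = j" | "x = i + 1" "y = j" | "x = i" "y = j - 1" | "x = i" "y = j + 1"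
    by blast
  then show "\<exists>x' y'. (x', y') \<in> W \<and> \<bar>x' - i\<bar> + \<bar>y' - j\<bar> = 1 \<and> (x', y') \<noteq> (x, y)"
    using assms(2)[of i j, unfolded balanced_def] ij xy w[of "i - 1" j] w[of "i + 1" j] w[of i "j - 1"] w[of i "j + 1"]
    by cases auto
qed

definition flip :: "int \<Rightarrow> (int \<times> int) set \<Rightarrow> (int \<times> int) set" where
  "flip m W = {(i, j). (i, m + 1 - j) \<in> W}"

definition mirror :: "int \<Rightarrow> int \<Rightarrow> (int \<times> int) set \<Rightarrow> (int \<times> int) set" where
  "mirror a b W = {(i, j). (a + b - i, j) \<in> W}"

lemma in_flip [simp]: "(i, j) \<in> flip m W \<longleftrightarrow> (i, m + 1 - j) \<in> W"
  by (simp add: flip_def)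

lemma in_mirror [simp]: "(i, j) \<in> mirror a b W \<longleftrightarrow> (a + b - i, j) \<in> W"
  by (simp add: mirror_def)

lemma flip_flip [simp]: "flip m (flip m W) = W"
  by (auto simp: flip_def)

lemma col_mirror [simp]: "col (mirror a b W) i = col W (a + b - i)"
  by auto

lemma col_flip: "col (flip m W) i = (\<lambda>j. m + 1 - j) ` col W i"
  by (force simp: image_iff)

lemma fort_flip:
  assumes "fort m a b W"
  shows "fort m a b (flip m W)"
proof (rule fortI)
  show "flip m W \<subseteq> {a..b} \<times> {1..m}"
    using fort_grid[OF assms] by fastforce
  fix i j assume "a \<le> i" "i \<le> b" "1 \<le> j" "j \<le> m" "(i, j) \<notin> flip m W"
  then have *: "a \<le> i" "i \<le> b" "1 \<le> m + 1 - j" "m + 1 - j \<le> m" "(i, m + 1 - j) \<notin> W" by auto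
  show "balanced (flip m W) i j"
    using fort_other[OF assms *] unfolding balanced_def by (simp add: algebra_simps) blast
qed

lemma fort_mirror:
  assumes "fort m a b W"
  shows "fort m a b (mirror a b W)"
proof (rule fortI)
  show "mirror a b W \<subseteq> {a..b} \<times> {1..m}"
    using fort_grid[OF assms] by fastforce
  fix i j assume "a \<le> i" "i \<le> b" "1 \<le> j" "j \<le> m" "(i, j) \<notin> mirror a b W"
  then have *: "a \<le> a + b - i" "a + b - i \<le> b" "1 \<le> j" "j \<le> m" "(a + b - i, j) \<notin> W" by auto
  show "balanced (mirror a b W) i j"
    using fort_other[OF assms *] unfolding balanced_def by (simp add: algebra_simps) blast
qed

text \<open>Exchanging rows and columns is what makes the theorem for fewer rows applicable to narrow pieces.\<close>

lemma fort_transpose_shift: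
  assumes "fort m a b W"
  shows "fort (b - a + 1) 1 m {(j, i). (i + a - 1, j) \<in> W}" (is "fort _ _ _ ?T")
proof (rule fortI)
  show "?T \<subseteq> {1..m} \<times> {1..b - a + 1}"
    using fort_grid[OF assms] by fastforce
  fix j i assume "1 \<le> j" "j \<le> m" "1 \<le> i" "i \<le> b - a + 1" "(j, i) \<notin> ?T"
  then have *: "a \<le> i + a - 1" "i + a - 1 \<le> b" "1 \<le> j" "j \<le> m" "(i + a - 1, j) \<notin> W" by auto
  show "balanced ?T j i"
    using fort_other[OF assms *] unfolding balanced_def by (simp add: algebra_simps) blast
qed

lemma fort_finite:
  assumes "fort m a b W"
  shows "finite W"
proof (rule finite_subset)
  show "W \<subseteq> {a..b} \<times> {1..m}" using assms by (simp add: fort_def)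
qed simp

lemma col_bounds:
  assumes "fort m a b W"
  shows "col W i \<subseteq> {1..m}" "finite (col W i)"
proof -
  show "col W i \<subseteq> {1..m}" using fort_grid[OF assms] by auto
  then show "finite (col W i)" using finite_subset by blast
qed

lemma col_outside:
  assumes "fort m a b W" "i < a \<or> b < i"
  shows "col W i = {}"
  using fort_grid[OF assms(1)] assms(2) by (force simp: col_def)

lemma card_fort_cols:
  assumes "fort m a b W"
  shows "int (card W) = (\<Sum>i\<in>{a..b}. int (card (col W i)))"
proof -
  have "W = (SIGMA i:{a..b}. col W i)"
    using fort_grid[OF assms] by auto
  then have "card W = (\<Sum>i\<in>{a..b}. card (col W i))"
    using col_bounds(2)[OF assms] card_SigmaI[of "{a..b}" "col W"] by simp
  then show ?thesis by simp
qed

section \<open>Fronts and plain columns\<close>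

definition full_fort :: "int \<Rightarrow> int \<Rightarrow> int \<Rightarrow> (int \<times> int) set \<Rightarrow> bool" where
  "full_fort m a b W \<longleftrightarrow> fort m a b W \<and> a \<le> b \<and> (\<forall>i. a \<le> i \<and> i \<le> b \<longrightarrow> col W i \<noteq> {})"

text \<open>The value \<open>0\<close> for an empty column acts as a row below the grid, so that the rules for fronts remain
  valid at the first and the last column.\<close>

definition front :: "(int \<times> int) set \<Rightarrow> int \<Rightarrow> int" where
  "front W i = (if col W i = {} then 0 else Max (col W i))"

text \<open>A column with a single white vertex \<open>l\<close> forces its two neighbours to agree in all rows other than
  \<open>l - 1\<close>, \<open>l\<close> and \<open>l + 1\<close>. It is plain if they have nothing in common there, so that near it the fort is
  just a strand through \<open>l\<close>. Otherwise other strands are reflected at this column, as at an empty one.\<close>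

definition plain :: "(int \<times> int) set \<Rightarrow> int \<Rightarrow> bool" where
  "plain W i \<longleftrightarrow> (\<exists>l. col W i = {l} \<and> (\<forall>t. (i - 1, t) \<in> W \<and> (i + 1, t) \<in> W \<longrightarrow> \<bar>t - l\<bar> \<le> 1))"

lemma full_fortD:
  assumes "full_fort m a b W"
  shows "fort m a b W" "a \<le> b" "\<And>i. a \<le> i \<Longrightarrow> i \<le> b \<Longrightarrow> col W i \<noteq> {}"
  using assms by (auto simp: full_fort_def)

lemma full_fort_flip: "full_fort m a b W \<Longrightarrow> full_fort m a b (flip m W)"
  unfolding full_fort_def by (simp add: fort_flip col_flip)

lemma full_fort_mirror: "full_fort m a b W \<Longrightarrow> full_fort m a b (mirror a b W)"
  unfolding full_fort_def by (simp add: fort_mirror)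

lemma card_col_flip [simp]: "card (col (flip m W) i) = card (col W i)"
  unfolding col_flip by (rule card_image) (auto simp: inj_on_def)

lemma plain_flip [simp]: "plain (flip m W) i \<longleftrightarrow> plain W i"
proof -
  have "plain (flip m W) i" if "plain W i" for W
  proof -
    from that obtain l where l: "col W i = {l}"
      "\<And>t. (i - 1, t) \<in> W \<Longrightarrow> (i + 1, t) \<in> W \<Longrightarrow> \<bar>t - l\<bar> \<le> 1"
      unfolding plain_def by blast
    have "col (flip m W) i = {m + 1 - l}" using l(1) by (simp add: col_flip)
    moreover have "\<bar>t - (m + 1 - l)\<bar> \<le> 1" if "(i - 1, t) \<in> flip m W" "(i + 1, t) \<in> flip m W" for t
      using l(2)[of "m + 1 - t"] that by auto
    ultimately show ?thesis unfolding plain_def by blast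
  qed
  from this[of W] this[of "flip m W"] show ?thesis by auto
qed

lemma plain_mirror [simp]: "plain (mirror a b W) i \<longleftrightarrow> plain W (a + b - i)"
  unfolding plain_def by (auto simp: algebra_simps)

lemma front_mirror [simp]: "front (mirror a b W) i = front W (a + b - i)"
  by (simp add: front_def)

lemma front_ge:
  assumes "fort m a b W" "(i, j) \<in> W"
  shows "j \<le> front W i"
  using assms col_bounds(2)[OF assms(1), of i] unfolding front_def by (auto simp: col_def)

lemma front_in:
  assumes "fort m a b W" "col W i \<noteq> {}"
  shows "(i, front W i) \<in> W"
  using assms col_bounds(2)[OF assms(1), of i] Max_in[of "col W i"] unfolding front_def by auto

lemma front_single: "col W i = {l} \<Longrightarrow> front W i = l"
  by (simp add: front_def)

lemma front_outside: "fort m a b W \<Longrightarrow> i < a \<or> b < i \<Longrightarrow> front W i = 0"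
  using col_outside by (simp add: front_def)

lemma front_bounds:
  assumes "full_fort m a b W" "a \<le> i" "i \<le> b"
  shows "(i, front W i) \<in> W" "1 \<le> front W i" "front W i \<le> m"
proof -
  note f = full_fortD[OF assms(1)]
  show "(i, front W i) \<in> W" using front_in[OF f(1) f(3)] assms by blast
  then show "1 \<le> front W i" "front W i \<le> m" using fort_grid[OF f(1)] by blast+
qed

text \<open>If the front of the next column is higher by more than one, then the vertex of column \<open>i\<close> next to it
  sees no white vertex above or below itself and needs the one on the other side.\<close>

lemma front_step:
  assumes "full_fort m a b W" "a \<le> i" "i \<le> b"
  shows "front W (i + 1) \<le> max (front W i + 1) (front W (i - 1))"
proof (rule ccontr)
  note f = full_fortD[OF assms(1)]
  assume "\<not> ?thesis"
  then have big: "front W i + 1 < front W (i + 1)" "front W (i - 1) < front W (i + 1)" by auto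
  let ?t = "front W (i + 1)"
  have "col W (i + 1) \<noteq> {}" using big(1) front_bounds(2)[OF assms] by (auto simp: front_def split: if_splits)
  then have t: "(i + 1, ?t) \<in> W" using front_in[OF f(1)] by blast
  have "(i, ?t) \<notin> W" "(i, ?t - 1) \<notin> W" "(i, ?t + 1) \<notin> W" "(i - 1, ?t) \<notin> W"
    using front_ge[OF f(1)] big by fastforce+
  then show False
    using fort_right[OF f(1) assms(2,3) _ _ _ t] fort_grid[OF f(1) t] by blast
qed

lemma front_step':
  assumes "full_fort m a b W" "a \<le> i" "i \<le> b"
  shows "front W (i - 1) \<le> max (front W i + 1) (front W (i + 1))"
  using front_step[OF full_fort_mirror[OF assms(1)], of "a + b - i"] assms by (simp add: algebra_simps)

text \<open>The vertex just above the front sees the front below and nothing above, so it needs a white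
  vertex to the left or to the right.\<close>

lemma front_grow:
  assumes "full_fort m a b W" "a \<le> i" "i \<le> b" "front W i < m"
  shows "front W i < front W (i - 1) \<or> front W i < front W (i + 1)"
proof -
  note f = full_fortD[OF assms(1)]
  let ?t = "front W i + 1"
  have "(i, ?t - 1) \<in> W" "1 \<le> ?t" using front_bounds[OF assms(1-3)] by auto
  moreover have "(i, ?t) \<notin> W" "(i, ?t + 1) \<notin> W" using front_ge[OF f(1)] by fastforce+
  ultimately have "(i - 1, ?t) \<in> W \<or> (i + 1, ?t) \<in> W"
    using fort_down[OF f(1) assms(2,3), of ?t] assms(4) by auto
  then show ?thesis using front_ge[OF f(1)] by fastforce
qed

text \<open>Intervals of columns are studied between two kinds of ends: a wall, or a plain column next to which
  something happens. In both cases the front does not descend when it leaves the end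
  (\<open>front_left_end\<close>).\<close>

definition left_end :: "int \<Rightarrow> (int \<times> int) set \<Rightarrow> int \<Rightarrow> bool" where
  "left_end a W u \<longleftrightarrow> u = a \<or> plain W u \<and> \<not> plain W (u + 1)"

definition right_end :: "int \<Rightarrow> (int \<times> int) set \<Rightarrow> int \<Rightarrow> bool" where
  "right_end b W v \<longleftrightarrow> v = b \<or> plain W v \<and> \<not> plain W (v - 1)"

lemma plain_next:
  assumes "fort m a b W" "a \<le> i" "i \<le> b" "plain W i" "col W i = {l}" "(i + 1, t) \<in> W"
  shows "\<bar>t - l\<bar> \<le> 1"
proof (rule ccontr)
  assume far: "\<not> ?thesis"
  have blk: "(i, j) \<notin> W" if "j \<noteq> l" for j using assms(5) that by (auto simp: col_def)
  have "(i, t) \<notin> W" "(i, t - 1) \<notin> W" "(i, t + 1) \<notin> W" using blk far by auto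
  then have "(i - 1, t) \<in> W"
    using fort_right[OF assms(1-3) _ _ _ assms(6)] fort_grid[OF assms(1,6)] by blast
  then show False using assms(4-6) far unfolding plain_def by auto
qed

text \<open>The column after a plain column stays within one row of it. A single white vertex there
  would be plain again, so there are at least two.\<close>

lemma nonplain_after_plain:
  assumes W: "full_fort m a b W" and u: "a \<le> u" "u < b" and p: "plain W u" and np: "\<not> plain W (u + 1)"
    and l: "col W u = {l}"
  shows "2 \<le> card (col W (u + 1))" "col W (u + 1) \<subseteq> {l - 1..l + 1}" "l \<le> front W (u + 1)" "front W (u + 1) \<le> l + 1"
proof -
  note f = full_fortD[OF W]
  have near: "\<bar>t - l\<bar> \<le> 1" if "(u + 1, t) \<in> W" for t
    using plain_next[OF f(1) _ _ p l that] u by auto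
  then show sub: "col W (u + 1) \<subseteq> {l - 1..l + 1}" by force
  have ne: "col W (u + 1) \<noteq> {}" using f(3)[of "u + 1"] u by auto
  have fin: "finite (col W (u + 1))" using col_bounds[OF f(1)] by blast
  show two: "2 \<le> card (col W (u + 1))"
  proof (rule ccontr)
    assume "\<not> ?thesis"
    moreover have "card (col W (u + 1)) \<noteq> 0" using ne fin by simp
    ultimately have "card (col W (u + 1)) = 1" by linarith
    then obtain t where t: "col W (u + 1) = {t}" by (rule card_1_singletonE)
    then have "(u + 1, t) \<in> W" by (auto simp: col_def)
    then have tl: "\<bar>t - l\<bar> \<le> 1" by (rule near)
    have "\<bar>s - t\<bar> \<le> 1" if "(u + 1 - 1, s) \<in> W" for s
    proof -
      have "s = l" using that l by (auto simp: col_def)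
      then show ?thesis using tl by simp
    qed
    then have "plain W (u + 1)" using t unfolding plain_def by blast
    then show False using np by blast
  qed
  have "\<not> col W (u + 1) \<subseteq> {l - 1}" using two card_mono[of "{l - 1}" "col W (u + 1)"] by auto
  then obtain t where "(u + 1, t) \<in> W" "t \<noteq> l - 1" by (auto simp: col_def)
  then show "l \<le> front W (u + 1)" using front_ge[OF f(1)] near by fastforce
  show "front W (u + 1) \<le> l + 1" using near[OF front_in[OF f(1) ne]] by auto
qed

lemma front_left_end:
  assumes W: "full_fort m a b W" and u: "a \<le> u" "u < b" and e: "left_end a W u"
  shows "front W (u + 1) \<le> front W u + 1 \<and> (front W u \<le> front W (u + 1) \<or> front W u = m)"
proof (cases "u = a")
  case True
  have 0: "front W (a - 1) = 0" using front_outside[OF full_fortD(1)[OF W]] by simp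
  have "1 \<le> front W a" "front W a \<le> m" using front_bounds[OF W] u by auto
  then show ?thesis
    using front_step[OF W u(1)] front_grow[OF W u(1)] u True 0 by force
next
  case False
  then have p: "plain W u" "\<not> plain W (u + 1)" using e by (auto simp: left_end_def)
  then obtain l where l: "col W u = {l}" unfolding plain_def by blast
  show ?thesis using nonplain_after_plain[OF W u p l] front_single[OF l] by auto
qed

lemma right_end_mirror: "right_end b W v \<longleftrightarrow> left_end a (mirror a b W) (a + b - v)"
  unfolding left_end_def right_end_def by (auto simp: algebra_simps)

lemma front_right_end:
  assumes W: "full_fort m a b W" and v: "a < v" "v \<le> b" and e: "right_end b W v"
  shows "front W (v - 1) \<le> front W v + 1 \<and> (front W v \<le> front W (v - 1) \<or> front W v = m)"
proof -
  have "left_end a (mirror a b W) (a + b - v)" using e right_end_mirror by blast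
  from front_left_end[OF full_fort_mirror[OF W] _ _ this] v show ?thesis
    by (simp add: algebra_simps)
qed

lemma end_flip [simp]: "left_end a (flip m W) u = left_end a W u" "right_end b (flip m W) v = right_end b W v"
  by (auto simp: left_end_def right_end_def)

definition up_steps :: "(int \<times> int) set \<Rightarrow> int \<Rightarrow> int \<Rightarrow> int set" where
  "up_steps W z v = {i. z \<le> i \<and> i < v \<and> front W i < front W (i + 1)}"

lemma finite_up_steps [simp]: "finite (up_steps W z v)"
  by (rule finite_subset[of _ "{z..v}"]) (auto simp: up_steps_def)

text \<open>Application of \<open>profile_bound\<close>. For the lowest white vertices the flipped fort is used.\<close>

lemma front_profile:
  assumes W: "full_fort m a b W" and uv: "a \<le> u" "u < v" "v \<le> b"
    and e: "left_end a W u" "right_end b W v"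
  obtains z where "u \<le> z" "z \<le> v" "front W z = m" "\<And>i. u \<le> i \<Longrightarrow> i < z \<Longrightarrow> front W i < m"
    "\<And>i. u < i \<Longrightarrow> i < z \<Longrightarrow> front W (i+1) = front W i + 1"
    "\<And>i. u \<le> i \<Longrightarrow> i < z \<Longrightarrow> front W i \<le> front W (i+1)"
    "\<And>i. u \<le> i \<Longrightarrow> i \<le> z \<Longrightarrow> m - (z - i) \<le> front W i"
    "2 * int (card (up_steps W z v)) + (m - front W u) + (m - front W v) \<le> v - u"
proof (rule profile_bound[of u v "front W" m])
  note f = full_fortD[OF W]
  show "u < v" by fact
  show "front W (i + 1) \<le> max (front W i + 1) (front W (i - 1))" if "u < i" "i < v" for i
    using front_step[OF W] that uv by auto
  show "front W (i - 1) \<le> max (front W i + 1) (front W (i + 1))" if "u < i" "i < v" for i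
    using front_step'[OF W] that uv by auto
  show "front W i < front W (i - 1) \<or> front W i < front W (i + 1)" if "u < i" "i < v" "front W i < m" for i
    using front_grow[OF W] that uv by auto
  show "front W i \<le> m" if "u \<le> i" "i \<le> v" for i using front_bounds(3)[OF W] that uv by auto
  note L = front_left_end[OF W uv(1) _ e(1)] and R = front_right_end[OF W _ uv(3) e(2)]
  show "front W (u + 1) \<le> front W u + 1" "front W u \<le> front W (u + 1) \<or> front W u = m" using L uv by auto
  show "front W (v - 1) \<le> front W v + 1" "front W v \<le> front W (v - 1) \<or> front W v = m" using R uv by auto
  show "u + 2 \<le> v \<or> front W u \<noteq> front W v \<or> front W u = m"
  proof (cases "u + 2 \<le> v")
    case False
    then have v: "v = u + 1" using uv by auto
    consider "u = a" | "v = b" | "plain W v" "\<not> plain W (u + 1)"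
      using e by (auto simp: left_end_def right_end_def)
    then show ?thesis
    proof cases
      case 1
      have "front W (a - 1) = 0" using front_outside[OF f(1)] by simp
      then show ?thesis using front_grow[OF W, of a] front_bounds[OF W, of a] 1 v uv by force
    next
      case 2
      have "front W (b + 1) = 0" using front_outside[OF f(1)] by simp
      then show ?thesis using front_grow[OF W, of b] front_bounds[OF W, of b] 2 v uv by force
    next
      case 3
      then show ?thesis using v by simp
    qed
  qed simp
qed (rule that[unfolded up_steps_def])

section \<open>Strands that fan out from the last column\<close>

text \<open>Two consecutive white vertices \<open>p < q\<close> of the last column bound a black gap. Seen from the right
  wall, the vertex next to each end of the gap can only be supported from the left, so the gap shrinks
  by one at both ends with every column: its boundary consists of two converging strands.\<close>

lemma fan_column:
  assumes W: "fort m a b W" and pq: "(b, p) \<in> W" "(b, q) \<in> W" "p < q"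
    and gap: "\<And>r. p < r \<Longrightarrow> r < q \<Longrightarrow> (b, r) \<notin> W"
    and k: "2 * int k < q - p"
  shows "(b - int k, p + int k) \<in> W \<and> (b - int k, q - int k) \<in> W \<and>
    (\<forall>r. p + int k < r \<and> r < q - int k \<longrightarrow> (b - int k, r) \<notin> W \<and> (b - int k + 1, r) \<notin> W)"
  using k
proof (induction k)
  case 0
  have "(b + 1, r) \<notin> W" for r using fort_grid(2)[OF W] by force
  then show ?case using pq gap by simp
next
  case (Suc k)
  define i where "i = b - int k"
  define p' where "p' = p + int k"
  define q' where "q' = q - int k"
  have IH: "(i, p') \<in> W" "(i, q') \<in> W" "\<And>r. p' < r \<Longrightarrow> r < q' \<Longrightarrow> (i, r) \<notin> W \<and> (i + 1, r) \<notin> W"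
    using Suc unfolding i_def p'_def q'_def by auto
  have w: "p' + 2 < q'" using Suc.prems unfolding p'_def q'_def by auto
  have g: "a \<le> i" "i \<le> b" "1 \<le> p'" "q' \<le> m" using fort_grid[OF W IH(1)] fort_grid[OF W IH(2)] by auto
  have c1: "(i - 1, p' + 1) \<in> W"
    using fort_down[OF W g(1,2), of "p' + 1"] IH w g by auto
  have c2: "(i - 1, q' - 1) \<in> W"
    using fort_up[OF W g(1,2), of "q' - 1"] IH w g by auto
  have c3: "(i - 1, r) \<notin> W" if "p' + 1 < r" "r < q' - 1" for r
    using fort_left[OF W g(1,2), of r] IH(3)[of r] IH(3)[of "r - 1"] IH(3)[of "r + 1"] that g by auto
  have shift: "b - int (Suc k) = i - 1" "p + int (Suc k) = p' + 1" "q - int (Suc k) = q' - 1"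
    unfolding i_def p'_def q'_def by auto
  show ?case unfolding shift using c1 c2 c3 IH(3) by auto
qed

text \<open>The distance between the highest and the lowest white vertex of a column, see \<open>front_flip_Min\<close>; written
  with fronts, as it arises from adding the bounds for a fort and its flipped version.\<close>

definition spread :: "int \<Rightarrow> (int \<times> int) set \<Rightarrow> int \<Rightarrow> int" where
  "spread m W i = front W i + front (flip m W) i - (m + 1)"

lemma front_flip_Min:
  assumes "fort m a b W" "col W i \<noteq> {}"
  shows "front (flip m W) i = m + 1 - Min (col W i)"
proof -
  have fin: "finite (col W i)" using col_bounds[OF assms(1)] by blast
  have "Max ((\<lambda>j. m + 1 - j) ` col W i) = m + 1 - Min (col W i)"
  proof (rule Max_eqI)
    show "finite ((\<lambda>j. m + 1 - j) ` col W i)" using fin by simp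
    show "m + 1 - Min (col W i) \<in> (\<lambda>j. m + 1 - j) ` col W i" using Min_in[OF fin assms(2)] by blast
    show "y \<le> m + 1 - Min (col W i)" if "y \<in> (\<lambda>j. m + 1 - j) ` col W i" for y
    proof -
      from that obtain j where "j \<in> col W i" "y = m + 1 - j" by blast
      then show ?thesis using Min_le[OF fin] by force
    qed
  qed
  then show ?thesis using assms(2) by (simp add: front_def col_flip)
qed

text \<open>Every gap of the last column contributes strands to about half as many columns as it is
  long. Hence in the last \<open>h\<close> columns, which the strands reach, the white vertices beyond two per column
  add up to about half the spread. This assumes a vertex above the highest
  gap strand in every column but the last. The columns without one form \<open>L\<close>; there the strand is itself the
  front and moves up to the right, so that \<open>profile_bound\<close> pays for them.\<close>

lemma end_fan:
  assumes W: "full_fort m a b W" and thick: "2 \<le> card (col W b)"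
  obtains h L where "1 \<le> h" "2 * h \<le> m" "a \<le> b - h + 1"
    "\<And>i. b - h < i \<Longrightarrow> i \<le> b \<Longrightarrow> 2 \<le> card (col W i)"
    "\<And>i. i \<in> L \<Longrightarrow> b - h < i \<and> i < b \<and> front W i < front W (i + 1) \<and> front W i \<le> m - (b - i)"
    "spread m W b \<le> 2 * (\<Sum>i\<in>{b-h<..b}. int (card (col W i)) - 2) + 2 + 2 * int (card L)"
proof -
  note f = full_fortD[OF W]
  define K where "K = col W b"
  have K: "finite K" "K \<noteq> {}" "K \<subseteq> {1..m}" "2 \<le> card K" "\<And>j. j \<in> K \<longleftrightarrow> (b, j) \<in> W"
    using col_bounds[OF f(1)] f(2) f(3)[of b] thick by (auto simp: K_def)
  define T where "T = Max K"
  have T: "T \<in> K" "\<And>j. j \<in> K \<Longrightarrow> j \<le> T" using K(1,2) unfolding T_def by auto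
  define B where "B = Min K"
  have B: "B \<in> K" "\<And>j. j \<in> K \<Longrightarrow> B \<le> j" using K(1,2) unfolding B_def by auto
  have "B < T"
  proof (rule ccontr)
    assume "\<not> B < T"
    then have "K \<subseteq> {T}" using T B by force
    then show False using K(4) card_mono[of "{T}" K] by auto
  qed
  \<comment> \<open>\<open>P j\<close>: the lower ends of the gaps that are still open \<open>j\<close> columns to the left of the wall.\<close>
  define P where "P j = {p \<in> K. p < T \<and> (\<forall>r. p < r \<and> r \<le> p + 2 * j \<longrightarrow> r \<notin> K)}" for j
  define nx where "nx p = Min {q \<in> K. p < q}" for p
  have nx: "nx p \<in> K" "p < nx p" "\<And>r. p < r \<Longrightarrow> r < nx p \<Longrightarrow> r \<notin> K" if "p < T" for p
  proof -
    have F: "finite {q \<in> K. p < q}" "{q \<in> K. p < q} \<noteq> {}" using K(1) T(1) that by auto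
    show "nx p \<in> K" "p < nx p" using Min_in[OF F] unfolding nx_def by auto
    show "r \<notin> K" if "p < r" "r < nx p" for r
      using Min_le[OF F(1), of r] that unfolding nx_def by auto
  qed
  have Pnx: "p \<in> K \<and> p < T \<and> p + 2 * j < nx p" if "p \<in> P j" for p j
  proof -
    have p: "p \<in> K" "p < T" "\<And>r. p < r \<Longrightarrow> r \<le> p + 2 * j \<Longrightarrow> r \<notin> K" using that unfolding P_def by auto
    then show ?thesis using nx(1,2)[OF p(2)] by force
  qed
  have finP: "finite (P j)" for j unfolding P_def using K(1) by simp
  have fan: "(b - j, p + j) \<in> W" "(b - j, nx p - j) \<in> W" if "p \<in> P j" "0 \<le> j" for p j
  proof -
    have "(b, p) \<in> W" "(b, nx p) \<in> W" "p < nx p" "\<And>r. p < r \<Longrightarrow> r < nx p \<Longrightarrow> (b, r) \<notin> W"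
      using Pnx[OF that(1)] nx[of p] K(5) by auto
    from fan_column[OF f(1) this, of "nat j"] that Pnx[OF that(1)]
    show "(b - j, p + j) \<in> W" "(b - j, nx p - j) \<in> W" by auto
  qed
  define J where "J = {j. 0 \<le> j \<and> P j \<noteq> {}}"
  have J0: "0 \<in> J" using B \<open>B < T\<close> unfolding J_def P_def by auto
  have Jb: "2 * (j + 1) \<le> m" if "j \<in> J" for j
  proof -
    from that obtain p where "p \<in> P j" unfolding J_def by auto
    from Pnx[OF this] nx(1)[of p] have "p \<in> K" "nx p \<in> K" "p + 2 * j < nx p" by auto
    then have "1 \<le> p" "nx p \<le> m" "p + 2 * j < nx p" using K(3) by auto
    then show "2 * (j + 1) \<le> m" by presburger
  qed
  have finJ: "finite J" by (rule finite_subset[of _ "{0..m}"]) (use Jb J_def in force)+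
  define h where "h = Max J + 1"
  have Jh: "J = {0..<h}"
  proof
    show "J \<subseteq> {0..<h}" using Max_ge[OF finJ] unfolding h_def J_def by force
    have "Max J \<in> J" using Max_in[OF finJ] J0 by auto
    then have "P (Max J) \<noteq> {}" unfolding J_def by simp
    moreover have "P (Max J) \<subseteq> P j" if "j \<le> Max J" for j using that unfolding P_def by auto
    ultimately show "{0..<h} \<subseteq> J" unfolding h_def J_def by force
  qed
  have h1: "1 \<le> h" using J0 Jh by auto
  have "h - 1 \<in> J" using h1 Jh by auto
  then have h2: "2 * h \<le> m" using Jb[of "h - 1"] by auto
  \<comment> \<open>Expected in column \<open>b - j\<close>: one lower strand per open gap, the upper strand of the highest gap, and one vertex above it.\<close>
  define L where "L = {b - j | j. j \<in> J \<and> 1 \<le> j \<and> int (card (col W (b - j))) \<le> int (card (P j)) + 1}"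
  have finc: "finite (col W i)" for i using col_bounds[OF f(1)] by blast
  have key: "int (card (P j)) + 1 \<le> int (card (col W (b - j)))"
    "b - j \<in> L \<Longrightarrow> front W (b - j) < front W (b - j + 1) \<and> front W (b - j) \<le> m - j"
    if j: "j \<in> J" for j
  proof -
    have j0: "0 \<le> j" "P j \<noteq> {}" using j unfolding J_def by auto
    define p where "p = Max (P j)"
    have p: "p \<in> P j" "\<And>p'. p' \<in> P j \<Longrightarrow> p' \<le> p" using finP j0(2) unfolding p_def by auto
    let ?q = "nx p - j"
    let ?S = "(\<lambda>p. p + j) ` P j"
    have cS: "card ?S = card (P j)" by (rule card_image) (auto simp: inj_on_def)
    have qS: "?q \<notin> ?S" using p Pnx[OF p(1)] by force
    have sub: "insert ?q ?S \<subseteq> col W (b - j)" using fan j0 p by auto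
    have cq: "card (insert ?q ?S) = card (P j) + 1" using cS qS finP by simp
    show "int (card (P j)) + 1 \<le> int (card (col W (b - j)))"
      using card_mono[OF finc sub] cq by linarith
    assume "b - j \<in> L"
    then have Lj: "1 \<le> j" "int (card (col W (b - j))) \<le> int (card (P j)) + 1" unfolding L_def by auto
    have "col W (b - j) = insert ?q ?S"
      using card_seteq[OF finc sub] cq Lj by auto
    moreover have "x \<le> ?q" if "x \<in> insert ?q ?S" for x
      using that p Pnx[OF p(1)] by force
    ultimately have t: "front W (b - j) = ?q"
      using front_in[OF f(1), of "b - j"] front_ge[OF f(1), of "b - j" ?q] by (force simp: col_def)
    have "p \<in> P (j - 1)" using p(1) unfolding P_def by auto
    then have "(b - (j - 1), nx p - (j - 1)) \<in> W" using fan Lj by auto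
    then have "nx p - j + 1 \<le> front W (b - j + 1)"
      using front_ge[OF f(1)] by (force simp: algebra_simps)
    moreover have "nx p \<le> m" using nx(1)[of p] Pnx[OF p(1)] K(3) by auto
    ultimately show "front W (b - j) < front W (b - j + 1) \<and> front W (b - j) \<le> m - j" using t by auto
  qed
  have sumcol: "(\<Sum>i\<in>{b-h<..b}. int (card (col W i)) - 2) = (\<Sum>j\<in>J. int (card (col W (b - j))) - 2)"
    by (rule sum.reindex_bij_witness[of _ "\<lambda>j. b - j" "\<lambda>i. b - i"]) (auto simp: Jh)
  have L_J: "L = (\<lambda>j. b - j) ` {j \<in> J. b - j \<in> L}" unfolding L_def by auto
  have cL: "int (card L) = (\<Sum>j\<in>J. if b - j \<in> L then 1 else 0)"
  proof -
    have "card L = card {j \<in> J. b - j \<in> L}"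
      by (subst L_J) (rule card_image, auto simp: inj_on_def)
    then show ?thesis using finJ by (simp add: sum.If_cases Int_def)
  qed
  have "(\<Sum>j\<in>J. int (card (P j)) - (if j = 0 then 1 else 0) - (if b - j \<in> L then 1 else 0))
      \<le> (\<Sum>j\<in>J. int (card (col W (b - j))) - 2)"
  proof (rule sum_mono)
    fix j assume j: "j \<in> J"
    show "int (card (P j)) - (if j = 0 then 1 else 0) - (if b - j \<in> L then 1 else 0) \<le> int (card (col W (b - j))) - 2"
    proof (cases "j = 0 \<or> b - j \<in> L")
      case True
      then show ?thesis using key(1)[OF j] by auto
    next
      case False
      then have "\<not> int (card (col W (b - j))) \<le> int (card (P j)) + 1"
        using j unfolding L_def J_def by auto
      then show ?thesis using False by auto
    qed
  qed
  also have "(\<Sum>j\<in>J. int (card (P j)) - (if j = 0 then 1 else 0) - (if b - j \<in> L then 1 else 0))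
      = (\<Sum>j\<in>J. int (card (P j))) - 1 - int (card L)"
    using finJ J0 by (simp add: sum_subtractf cL)
  finally have A: "(\<Sum>j\<in>J. int (card (P j))) - 1 - int (card L) \<le> (\<Sum>j\<in>J. int (card (col W (b - j))) - 2)" .
  let ?S = "Sigma J P"
  have finS: "finite ?S" using finJ finP by auto
  \<comment> \<open>Each unit of spread belongs to a gap and to the column in which one of the two strands passes it.\<close>
  have "{B..<T} \<subseteq> (\<lambda>(j, p). p + j) ` ?S \<union> (\<lambda>(j, p). nx p - 1 - j) ` ?S"
  proof
    fix r assume r: "r \<in> {B..<T}"
    define p where "p = Max {p \<in> K. p \<le> r}"
    have F: "finite {p \<in> K. p \<le> r}" "{p \<in> K. p \<le> r} \<noteq> {}" using K(1) B(1) r by auto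
    have p: "p \<in> K" "p \<le> r" using Max_in[OF F] unfolding p_def by auto
    have pm: "p' \<le> p" if "p' \<in> K" "p' \<le> r" for p'
      unfolding p_def by (rule Max_ge[OF F(1)]) (use that in auto)
    have pT: "p < T" using p r by auto
    have rq: "r < nx p" using pm[of "nx p"] nx[OF pT] by force
    define j where "j = min (r - p) (nx p - 1 - r)"
    have j: "0 \<le> j" "2 * j < nx p - p" using p rq unfolding j_def by (auto simp: min_def)
    have "p \<in> P j" unfolding P_def using p pT j nx(3)[OF pT] by auto
    then have "(j, p) \<in> ?S" using j unfolding J_def by auto
    moreover have "r = p + j \<or> r = nx p - 1 - j" unfolding j_def by auto
    ultimately show "r \<in> (\<lambda>(j, p). p + j) ` ?S \<union> (\<lambda>(j, p). nx p - 1 - j) ` ?S" by force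
  qed
  then have "card {B..<T} \<le> card ((\<lambda>(j, p). p + j) ` ?S \<union> (\<lambda>(j, p). nx p - 1 - j) ` ?S)"
    using finS by (intro card_mono) auto
  also have "\<dots> \<le> card ((\<lambda>(j, p). p + j) ` ?S) + card ((\<lambda>(j, p). nx p - 1 - j) ` ?S)" by (rule card_Un_le)
  also have "\<dots> \<le> card ?S + card ?S" using card_image_le[OF finS] add_mono by blast
  also have "card ?S = (\<Sum>j\<in>J. card (P j))" using finJ finP by simp
  finally have "nat (T - B) \<le> (\<Sum>j\<in>J. card (P j)) + (\<Sum>j\<in>J. card (P j))" by simp
  then have "T - B \<le> int ((\<Sum>j\<in>J. card (P j)) + (\<Sum>j\<in>J. card (P j)))" by (simp only: nat_le_iff)
  then have "T - B \<le> 2 * (\<Sum>j\<in>J. int (card (P j)))" by simp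
  moreover have "spread m W b = T - B"
    using front_flip_Min[OF f(1), of b] f K(2) unfolding spread_def T_def B_def K_def front_def by auto
  ultimately have main: "spread m W b \<le> 2 * (\<Sum>i\<in>{b-h<..b}. int (card (col W i)) - 2) + 2 + 2 * int (card L)"
    using A sumcol by linarith
  have c2: "2 \<le> card (col W i)" if "b - h < i" "i \<le> b" for i
  proof -
    have "b - i \<in> J" using that Jh by auto
    moreover from this have "card (P (b - i)) \<noteq> 0" using finP unfolding J_def by auto
    ultimately show ?thesis using key(1)[of "b - i"] by auto
  qed
  have "col W (b - h + 1) \<noteq> {}" using c2[of "b - h + 1"] h1 by auto
  then have "a \<le> b - h + 1" using col_outside[OF f(1)] by force
  moreover have "b - h < i \<and> i < b \<and> front W i < front W (i + 1) \<and> front W i \<le> m - (b - i)" if "i \<in> L" for i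
  proof -
    from that have "b - i \<in> J" "1 \<le> b - i" unfolding L_def by auto
    then show ?thesis using key(2)[of "b - i"] that Jh by auto
  qed
  ultimately show thesis using that[OF h1 h2] c2 main by blast
qed

section \<open>The excess between plain columns and walls\<close>

definition excess :: "(int \<times> int) set \<Rightarrow> int set \<Rightarrow> int" where
  "excess W I = (\<Sum>i\<in>I. int (card (col W i)) - 1)"

definition singles :: "(int \<times> int) set \<Rightarrow> int set \<Rightarrow> int set" where
  "singles W I = {i \<in> I. card (col W i) = 1}"

lemma finite_singles [simp]: "finite I \<Longrightarrow> finite (singles W I)"
  unfolding singles_def by (rule finite_subset[of _ I]) auto

lemma singlesE:
  assumes "i \<in> singles W I"
  obtains l where "col W i = {l}" "i \<in> I"
proof -
  have "card (col W i) = 1" "i \<in> I" using assms by (auto simp: singles_def)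
  then show thesis using that card_1_singletonE by metis
qed

lemma card_col_pos:
  assumes "full_fort m a b W" "a \<le> i" "i \<le> b"
  shows "1 \<le> card (col W i)"
proof -
  note f = full_fortD[OF assms(1)]
  have "card (col W i) \<noteq> 0" using f(3)[OF assms(2,3)] col_bounds(2)[OF f(1)] by simp
  then show ?thesis by simp
qed

lemma excess_lower:
  assumes W: "full_fort m a b W" and I: "I \<subseteq> {a..b}" and G: "G \<subseteq> I" "\<And>i. i \<in> G \<Longrightarrow> 2 \<le> card (col W i)"
  shows "int (card I) - int (card (singles W I)) + (\<Sum>i\<in>G. int (card (col W i)) - 2) \<le> excess W I"
proof -
  have fin: "finite I" using I finite_subset by blast
  have "int (card (singles W I)) = (\<Sum>i\<in>I. if card (col W i) = 1 then 1 else 0)"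
    using fin by (simp add: singles_def sum.If_cases Int_def)
  moreover have "int (card I) = (\<Sum>i\<in>I. 1)" by simp
  moreover have "(\<Sum>i\<in>G. int (card (col W i)) - 2) = (\<Sum>i\<in>I. if i \<in> G then int (card (col W i)) - 2 else 0)"
    using fin G(1) by (simp add: sum.If_cases Int_absorb1 inf.absorb2 Int_def[symmetric])
  ultimately have "int (card I) - int (card (singles W I)) + (\<Sum>i\<in>G. int (card (col W i)) - 2)
    = (\<Sum>i\<in>I. 1 - (if card (col W i) = 1 then 1 else 0) + (if i \<in> G then int (card (col W i)) - 2 else 0))"
    by (simp add: sum.distrib sum_subtractf)
  also have "\<dots> \<le> excess W I"
    unfolding excess_def
  proof (rule sum_mono)
    fix i assume i: "i \<in> I"
    then have "1 \<le> card (col W i)" using card_col_pos[OF W] I by auto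
    then show "1 - (if card (col W i) = 1 then 1 else 0) + (if i \<in> G then int (card (col W i)) - 2 else 0)
        \<le> int (card (col W i)) - 1"
      using G(2)[of i] by (cases "i \<in> G") auto
  qed
  finally show ?thesis .
qed

lemma excess_mono:
  assumes W: "full_fort m a b W" and "I \<subseteq> I'" "I' \<subseteq> {a..b}"
  shows "excess W I \<le> excess W I'"
  unfolding excess_def
proof (rule sum_mono2)
  show "finite I'" using assms finite_subset by blast
  show "0 \<le> int (card (col W i)) - 1" if "i \<in> I' - I" for i
    using card_col_pos[OF W, of i] that assms by auto
qed (use assms in auto)

lemma excess_nonneg:
  assumes "full_fort m a b W" "I \<subseteq> {a..b}"
  shows "0 \<le> excess W I"
  using excess_mono[OF assms(1) _ assms(2), of "{}"] by (simp add: excess_def)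

lemma end_single_plain:
  assumes "full_fort m a b W" "col W b = {l}"
  shows "plain W b"
  unfolding plain_def using assms(2) fort_grid(2)[OF full_fortD(1)[OF assms(1)], of "b + 1"] by force

lemma end_not_single:
  assumes "full_fort m a b W" "\<not> plain W b"
  shows "card (col W b) \<noteq> 1"
  using end_single_plain[OF assms(1)] assms(2) card_1_singletonE by metis

text \<open>The strand that is reflected at the column runs either above or below its single vertex, so one of the
  two fronts has a hole there.\<close>

lemma nonplain_single_jump:
  assumes W: "full_fort m a b W" and l: "col W i = {l}" and np: "\<not> plain W i"
  shows "front W i < front W (i - 1) \<and> front W i < front W (i + 1) \<or>
    front (flip m W) i < front (flip m W) (i - 1) \<and> front (flip m W) i < front (flip m W) (i + 1)"
proof -
  note f = full_fortD(1)[OF W]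
  note f' = full_fortD(1)[OF full_fort_flip[OF W]]
  obtain t where t: "(i - 1, t) \<in> W" "(i + 1, t) \<in> W" "\<bar>t - l\<bar> > 1"
    using l np unfolding plain_def by force
  show ?thesis
  proof (cases "l < t")
    case True
    then show ?thesis using front_ge[OF f t(1)] front_ge[OF f t(2)] front_single[OF l] by auto
  next
    case False
    have "front (flip m W) i = m + 1 - l" using l by (intro front_single) (simp add: col_flip)
    moreover have "(i - 1, m + 1 - t) \<in> flip m W" "(i + 1, m + 1 - t) \<in> flip m W" using t by auto
    ultimately show ?thesis using front_ge[OF f', of "i-1" "m+1-t"] front_ge[OF f', of "i+1" "m+1-t"] t(3) False by auto
  qed
qed

text \<open>Before its first visit \<open>z\<close> of the top row the front does not descend; a hole can only occur later, where
  the steps out of it are counted.\<close>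

lemma jump_in_up_steps:
  assumes "u < i" "i < v" "front W i < front W (i - 1)" "front W i < front W (i + 1)"
    and "\<And>i. u \<le> i \<Longrightarrow> i < z \<Longrightarrow> front W i \<le> front W (i + 1)"
  shows "i \<in> up_steps W z v"
proof -
  have "z \<le> i"
  proof (rule ccontr)
    assume "\<not> z \<le> i"
    then have "front W (i - 1) \<le> front W i" using assms(5)[of "i - 1"] assms(1) by auto
    then show False using assms(3) by simp
  qed
  then show ?thesis using assms unfolding up_steps_def by simp
qed

lemma spread_single: "col W i = {l} \<Longrightarrow> spread m W i = 0"
  by (simp add: spread_def front_def col_flip)

lemma spread_le:
  assumes "full_fort m a b W" "a \<le> i" "i \<le> b"
  shows "spread m W i \<le> m - 1"
  using front_bounds(3)[OF assms] front_bounds(3)[OF full_fort_flip[OF assms(1)] assms(2,3)]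
  by (simp add: spread_def)

text \<open>Sum of the bounds for the upper and the lower front: together they have to cross \<open>2 m - 2\<close> rows,
  less what the ends of the interval span already, and every jump costs one more column.\<close>

lemma interval_jumps:
  assumes W: "full_fort m a b W" and uv: "a \<le> u" "u < v" "v \<le> b"
    and e: "left_end a W u" "right_end b W v"
    and np: "\<And>i. u < i \<Longrightarrow> i < v \<Longrightarrow> \<not> plain W i"
  shows "2 * int (card (singles W {u<..<v})) + (2 * m - 2 - spread m W u - spread m W v) \<le> 2 * (v - u)"
proof -
  let ?F = "flip m W"
  obtain z where z: "\<And>i. u \<le> i \<Longrightarrow> i < z \<Longrightarrow> front W i \<le> front W (i+1)"
    "2 * int (card (up_steps W z v)) + (m - front W u) + (m - front W v) \<le> v - u"
    using front_profile[OF W uv e] by metis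
  have e': "left_end a ?F u" "right_end b ?F v" using e by auto
  obtain z' where z': "\<And>i. u \<le> i \<Longrightarrow> i < z' \<Longrightarrow> front ?F i \<le> front ?F (i+1)"
    "2 * int (card (up_steps ?F z' v)) + (m - front ?F u) + (m - front ?F v) \<le> v - u"
    using front_profile[OF full_fort_flip[OF W] uv e'] by metis
  have "singles W {u<..<v} \<subseteq> up_steps W z v \<union> up_steps ?F z' v"
  proof
    fix i assume "i \<in> singles W {u<..<v}"
    then obtain l where l: "col W i = {l}" "u < i" "i < v" by (auto elim: singlesE)
    show "i \<in> up_steps W z v \<union> up_steps ?F z' v"
      using nonplain_single_jump[OF W l(1) np[OF l(2,3)]]
        jump_in_up_steps[OF l(2,3) _ _ z(1)] jump_in_up_steps[OF l(2,3) _ _ z'(1)] by blast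
  qed
  then have "card (singles W {u<..<v}) \<le> card (up_steps W z v \<union> up_steps ?F z' v)"
    by (intro card_mono) auto
  also have "\<dots> \<le> card (up_steps W z v) + card (up_steps ?F z' v)" by (rule card_Un_le)
  finally have "int (card (singles W {u<..<v})) \<le> int (card (up_steps W z v)) + int (card (up_steps ?F z' v))"
    by linarith
  then show ?thesis using z(2) z'(2) unfolding spread_def by (simp add: algebra_simps)
qed

text \<open>This is the tilted rectangle: between two plain columns that are not adjacent, the upper front
  has to reach the top and the lower front the bottom, which takes \<open>m - 1\<close> steps.\<close>

lemma plain_gap_excess:
  assumes W: "full_fort m a b W" and uv: "a \<le> u" "u + 2 \<le> v" "v \<le> b" and p: "plain W u" "plain W v"
    and np: "\<And>i. u < i \<Longrightarrow> i < v \<Longrightarrow> \<not> plain W i"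
  shows "m - 2 \<le> excess W {u<..<v}"
proof -
  have sub: "{u<..<v} \<subseteq> {a..b}" using uv by (auto intro: order_trans less_imp_le)
  have e: "left_end a W u" "right_end b W v"
    using p np[of "u+1"] np[of "v-1"] uv by (auto simp: left_end_def right_end_def)
  obtain l l' where "col W u = {l}" "col W v = {l'}" using p unfolding plain_def by blast
  then have "spread m W u = 0" "spread m W v = 0" using spread_single by auto
  then have "2 * int (card (singles W {u<..<v})) + (2 * m - 2) \<le> 2 * (v - u)"
    using interval_jumps[OF W uv(1) _ uv(3) e np] uv by auto
  moreover have "int (card {u<..<v}) - int (card (singles W {u<..<v})) \<le> excess W {u<..<v}"
    using excess_lower[OF W, of "{u<..<v}" "{}"] sub by auto
  moreover have "int (card {u<..<v}) = v - u - 1" using uv by simp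
  ultimately show ?thesis by (simp add: algebra_simps)
qed

lemma singles_right_end:
  assumes W: "full_fort m a b W" and "\<not> plain W b"
  shows "singles W {u<..b} = singles W {u<..<b}"
proof -
  have "card (col W b) \<noteq> 1" using end_not_single[OF assms] .
  then show ?thesis unfolding singles_def by (auto simp: less_le)
qed

text \<open>Half a rectangle, cut off by the right wall. The last column can span at most \<open>m - 1\<close> rows, which
  halves the bound.\<close>

lemma right_half_excess:
  assumes W: "full_fort m a b W" and u: "a \<le> u" "u < b" and p: "plain W u"
    and np: "\<And>i. u < i \<Longrightarrow> i \<le> b \<Longrightarrow> \<not> plain W i"
  shows "m - 1 \<le> 2 * excess W {u<..b}"
proof -
  have sub: "{u<..b} \<subseteq> {a..b}" using u by auto
  have e: "left_end a W u" "right_end b W b"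
    using p np[of "u+1"] u by (auto simp: left_end_def right_end_def)
  obtain l where "col W u = {l}" using p unfolding plain_def by blast
  then have "spread m W u = 0" using spread_single by auto
  moreover have "spread m W b \<le> m - 1" using spread_le[OF W] u by auto
  ultimately have "2 * int (card (singles W {u<..b})) + (m - 1) \<le> 2 * (b - u)"
    using interval_jumps[OF W u(1) u(2) _ e] np u singles_right_end[OF W np[of b]] by auto
  moreover have "int (card {u<..b}) - int (card (singles W {u<..b})) \<le> excess W {u<..b}"
    using excess_lower[OF W, of "{u<..b}" "{}"] sub by auto
  moreover have "int (card {u<..b}) = b - u" using u by simp
  ultimately show ?thesis by (simp add: algebra_simps)
qed

text \<open>If the upper front reaches the top before the last column, half a rectangle cannot end there
  symmetrically. What the spread of the last column saves in \<open>interval_jumps\<close> is returned by its fan.\<close>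

lemma right_fan_excess:
  assumes W: "full_fort m a b W" and u: "a \<le> u" "u < b" and p: "plain W u"
    and np: "\<And>i. u < i \<Longrightarrow> i \<le> b \<Longrightarrow> \<not> plain W i"
    and hit: "u \<le> z0" "z0 < b" "front W z0 = m"
  shows "m - 2 \<le> excess W {u<..b}"
proof -
  have arith: "m - 2 \<le> E" if "C - X + S \<le> E" "C = b - u" "tu + fu - (m + 1) = 0"
      "tb + fb - (m + 1) \<le> 2 * S + 2 + 2 * l" "2 * U + (m - tu) + (m - tb) \<le> b - u"
      "2 * U' + (m - fu) + (m - fb) \<le> b - u" "X + l \<le> U + U'"
    for C X S E tu fu tb fb l U U' :: int
    using that by linarith
  let ?F = "flip m W"
  note f = full_fortD(1)[OF W]
  have e: "left_end a W u" "right_end b W b"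
    using p np[of "u+1"] u by (auto simp: left_end_def right_end_def)
  obtain z where z: "u \<le> z" "\<And>i. u \<le> i \<Longrightarrow> i < z \<Longrightarrow> front W i < m"
    "\<And>i. u \<le> i \<Longrightarrow> i < z \<Longrightarrow> front W i \<le> front W (i+1)"
    "\<And>i. u \<le> i \<Longrightarrow> i \<le> z \<Longrightarrow> m - (z - i) \<le> front W i"
    "2 * int (card (up_steps W z b)) + (m - front W u) + (m - front W b) \<le> b - u"
    using front_profile[OF W u(1,2) order_refl e] by metis
  have zb: "z < b" using z(2)[of z0] hit by (cases "z0 < z") auto
  have e': "left_end a ?F u" "right_end b ?F b" using e by auto
  obtain z' where z': "\<And>i. u \<le> i \<Longrightarrow> i < z' \<Longrightarrow> front ?F i \<le> front ?F (i+1)"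
    "2 * int (card (up_steps ?F z' b)) + (m - front ?F u) + (m - front ?F b) \<le> b - u"
    using front_profile[OF full_fort_flip[OF W] u(1,2) order_refl e'] by metis
  obtain l where l: "col W u = {l}" using p unfolding plain_def by blast
  have "card (col W b) \<noteq> 1" using end_not_single[OF W] np[of b] u by auto
  then have "2 \<le> card (col W b)" using card_col_pos[OF W, of b] u by auto
  from end_fan[OF W this] obtain h L where h: "1 \<le> h"
    and thick: "\<And>i. b - h < i \<Longrightarrow> i \<le> b \<Longrightarrow> 2 \<le> card (col W i)"
    and L: "\<And>i. i \<in> L \<Longrightarrow> b - h < i \<and> i < b \<and> front W i < front W (i + 1) \<and> front W i \<le> m - (b - i)"
    and sp: "spread m W b \<le> 2 * (\<Sum>i\<in>{b-h<..b}. int (card (col W i)) - 2) + 2 + 2 * int (card L)"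
    by metis
  have uh: "u \<le> b - h" using thick[of u] l u by force
  let ?X = "singles W {u<..b}"
  have X: "?X \<subseteq> up_steps W z b \<union> up_steps ?F z' b"
  proof
    fix i assume "i \<in> ?X"
    then have "i \<in> singles W {u<..<b}" using singles_right_end[OF W np[of b]] u by auto
    then obtain l where l: "col W i = {l}" "u < i" "i < b" by (auto elim: singlesE)
    show "i \<in> up_steps W z b \<union> up_steps ?F z' b"
      using nonplain_single_jump[OF W l(1) np[of i]] l
        jump_in_up_steps[OF l(2,3) _ _ z(3)] jump_in_up_steps[OF l(2,3) _ _ z'(1)] by auto
  qed
  \<comment> \<open>Before \<open>z\<close> the front is too high: \<open>z < b\<close> and it falls by at most one per column to the left of \<open>z\<close>.\<close>
  have LU: "L \<subseteq> up_steps W z b"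
  proof
    fix i assume "i \<in> L"
    note i = L[OF this]
    have "z \<le> i"
    proof (rule ccontr)
      assume "\<not> z \<le> i"
      then have "m - (z - i) \<le> front W i" using z(4)[of i] i uh by auto
      then show False using i zb by linarith
    qed
    then show "i \<in> up_steps W z b" using i unfolding up_steps_def by auto
  qed
  have finL: "finite L" using finite_subset[OF LU] by simp
  have finX: "finite ?X" by simp
  have "?X \<inter> L = {}" using thick L unfolding singles_def by force
  then have "card ?X + card L = card (?X \<union> L)" using card_Un_disjoint[OF finX finL] by simp
  also have "\<dots> \<le> card (up_steps W z b \<union> up_steps ?F z' b)" using X LU by (intro card_mono) auto
  also have "\<dots> \<le> card (up_steps W z b) + card (up_steps ?F z' b)" by (rule card_Un_le)
  finally have XL: "int (card ?X) + int (card L) \<le> int (card (up_steps W z b)) + int (card (up_steps ?F z' b))" by linarith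
  have f1: "int (card {u<..b}) - int (card ?X) + (\<Sum>i\<in>{b-h<..b}. int (card (col W i)) - 2) \<le> excess W {u<..b}"
    using thick uh u by (intro excess_lower[OF W]) auto
  have f2: "int (card {u<..b}) = b - u" using u by simp
  have f3: "spread m W u = 0" using spread_single[OF l] .
  from arith[OF f1 f2 f3[unfolded spread_def] sp[unfolded spread_def] z(5) z'(2) XL]
  show ?thesis .
qed

text \<open>Without plain columns both ends are thick. The fan at the right wall is charged to the upper front,
  the fan at the left wall to the lower one, which are exchanged by the rotation \<open>?R\<close>. The width is needed to keep the
  two fans apart and to make sure that each front reaches its wall before the end.\<close>

lemma excess_no_plain:
  assumes W: "full_fort m a b W" and wide: "m \<le> b - a + 1"
    and np: "\<And>i. a \<le> i \<Longrightarrow> i \<le> b \<Longrightarrow> \<not> plain W i"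
  shows "m - 2 \<le> excess W {a..b}"
proof (cases "m \<le> 2")
  case True
  then show ?thesis using excess_nonneg[OF W, of "{a..b}"] by simp
next
  case False
  let ?R = "mirror a b (flip m W)"
  have R: "full_fort m a b ?R" using W by (intro full_fort_mirror full_fort_flip)
  note f = full_fortD[OF W]
  have ab: "a < b" using False wide by simp
  have e: "left_end a W a" "right_end b W b" "left_end a ?R a" "right_end b ?R b"
    by (auto simp: left_end_def right_end_def)
  have nb: "2 \<le> card (col V b)" if "full_fort m a b V" "\<not> plain V b" for V
  proof -
    have "card (col V b) \<noteq> 1" using end_not_single[OF that] .
    then show ?thesis using card_col_pos[OF that(1), of b] ab by auto
  qed
  have npR: "\<not> plain ?R i" if "a \<le> i" "i \<le> b" for i using np[of "a + b - i"] that by simp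
  have start: "2 \<le> front V a" if "full_fort m a b V" "2 \<le> card (col V a)" for V
  proof (rule ccontr)
    assume "\<not> 2 \<le> front V a"
    then have "col V a \<subseteq> {1}"
      using front_ge[OF full_fortD(1)[OF that(1)], of a] fort_grid(3)[OF full_fortD(1)[OF that(1)]] by fastforce
    then show False using that(2) card_mono[of "{1}" "col V a"] by auto
  qed
  have prof: "\<exists>z<b. a \<le> z \<and> (\<forall>i. a \<le> i \<and> i < z \<longrightarrow> front V i \<le> front V (i+1)) \<and>
      (\<forall>i. a \<le> i \<and> i \<le> z \<longrightarrow> m - (z - i) \<le> front V i) \<and>
      2 * int (card (up_steps V z b)) + (m - front V a) + (m - front V b) \<le> b - a"
    if V: "full_fort m a b V" and c: "2 \<le> card (col V a)" for V
  proof -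
    have e: "left_end a V a" "right_end b V b" by (auto simp: left_end_def right_end_def)
    obtain z where z: "a \<le> z" "z \<le> b" "front V z = m" "\<And>i. a \<le> i \<Longrightarrow> i < z \<Longrightarrow> front V i < m"
      "\<And>i. a < i \<Longrightarrow> i < z \<Longrightarrow> front V (i+1) = front V i + 1"
      "\<And>i. a \<le> i \<Longrightarrow> i < z \<Longrightarrow> front V i \<le> front V (i+1)"
      "\<And>i. a \<le> i \<Longrightarrow> i \<le> z \<Longrightarrow> m - (z - i) \<le> front V i"
      "2 * int (card (up_steps V z b)) + (m - front V a) + (m - front V b) \<le> b - a"
      by (rule front_profile[OF V order_refl ab order_refl e]) (rule that; assumption)
    have "z \<noteq> b"
    proof
      assume zb: "z = b"
      have "front V (a - 1) = 0" using front_outside[OF full_fortD(1)[OF V]] by simp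
      then have a1: "front V a + 1 \<le> front V (a + 1)"
        using front_grow[OF V, of a] z(4)[of a] front_bounds(2)[OF V, of a] ab zb by auto
      have "front V a + (i - a) \<le> front V i" if "a + 1 \<le> i" "i \<le> b" for i
        using that
      proof (induction i rule: int_ge_induct)
        case base then show ?case using a1 by simp
      next
        case (step i) then show ?case using z(5)[of i] zb by auto
      qed
      from this[of b] show False using start[OF V c] z(3) zb ab wide by simp
    qed
    then have "z < b" using z(2) by simp
    then show ?thesis using z(1,6,7,8) by blast
  qed
  have cb: "2 \<le> card (col W b)" "2 \<le> card (col ?R b)" using nb[OF W np[of b]] nb[OF R npR[of b]] ab by auto
  then have ca: "2 \<le> card (col W a)" "2 \<le> card (col ?R a)" by auto
  obtain z where z: "z < b" "a \<le> z" "\<And>i. a \<le> i \<Longrightarrow> i < z \<Longrightarrow> front W i \<le> front W (i+1)"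
    "\<And>i. a \<le> i \<Longrightarrow> i \<le> z \<Longrightarrow> m - (z - i) \<le> front W i"
    "2 * int (card (up_steps W z b)) + (m - front W a) + (m - front W b) \<le> b - a"
    using prof[OF W ca(1)] by blast
  obtain z' where z': "z' < b" "a \<le> z'" "\<And>i. a \<le> i \<Longrightarrow> i < z' \<Longrightarrow> front ?R i \<le> front ?R (i+1)"
    "\<And>i. a \<le> i \<Longrightarrow> i \<le> z' \<Longrightarrow> m - (z' - i) \<le> front ?R i"
    "2 * int (card (up_steps ?R z' b)) + (m - front ?R a) + (m - front ?R b) \<le> b - a"
    using prof[OF R ca(2)] by blast
  obtain h L where h: "2 * h \<le> m"
    and thick: "\<And>i. b - h < i \<Longrightarrow> i \<le> b \<Longrightarrow> 2 \<le> card (col W i)"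
    and L: "\<And>i. i \<in> L \<Longrightarrow> b - h < i \<and> i < b \<and> front W i < front W (i + 1) \<and> front W i \<le> m - (b - i)"
    and ah: "a \<le> b - h + 1"
    and sp: "spread m W b \<le> 2 * (\<Sum>i\<in>{b-h<..b}. int (card (col W i)) - 2) + 2 + 2 * int (card L)"
    using end_fan[OF W cb(1)] by metis
  obtain h' L' where h': "2 * h' \<le> m"
    and thick': "\<And>i. b - h' < i \<Longrightarrow> i \<le> b \<Longrightarrow> 2 \<le> card (col ?R i)"
    and L': "\<And>i. i \<in> L' \<Longrightarrow> b - h' < i \<and> i < b \<and> front ?R i < front ?R (i + 1) \<and> front ?R i \<le> m - (b - i)"
    and ah': "a \<le> b - h' + 1"
    and sp': "spread m ?R b \<le> 2 * (\<Sum>i\<in>{b-h'<..b}. int (card (col ?R i)) - 2) + 2 + 2 * int (card L')"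
    using end_fan[OF R cb(2)] by metis
  have sub: "L \<subseteq> up_steps W z b"
  proof
    fix i assume "i \<in> L"
    note i = L[OF this]
    have "z \<le> i"
    proof (rule ccontr)
      assume "\<not> z \<le> i"
      then have "m - (z - i) \<le> front W i" using z(4)[of i] i ah by auto
      then show False using i z(1) by linarith
    qed
    then show "i \<in> up_steps W z b" using i unfolding up_steps_def by auto
  qed
  have sub': "L' \<subseteq> up_steps ?R z' b"
  proof
    fix i assume "i \<in> L'"
    note i = L'[OF this]
    have "z' \<le> i"
    proof (rule ccontr)
      assume "\<not> z' \<le> i"
      then have "m - (z' - i) \<le> front ?R i" using z'(4)[of i] i ah' by auto
      then show False using i z'(1) by linarith
    qed
    then show "i \<in> up_steps ?R z' b" using i unfolding up_steps_def by auto
  qed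
  let ?s = "\<lambda>i. a + b - i"
  let ?X = "singles W {a..b}"
  have X: "?X \<subseteq> up_steps W z b \<union> ?s ` up_steps ?R z' b"
  proof
    fix i assume "i \<in> ?X"
    then obtain l where l: "col W i = {l}" "a \<le> i" "i \<le> b" by (auto elim: singlesE)
    then have i: "a < i" "i < b" using cb ca by (auto simp: less_le)
    consider "front W i < front W (i - 1)" "front W i < front W (i + 1)"
      | "front ?R (?s i) < front ?R (?s i - 1)" "front ?R (?s i) < front ?R (?s i + 1)"
      using nonplain_single_jump[OF W l(1) np[OF l(2,3)]] by (auto simp: algebra_simps)
    then show "i \<in> up_steps W z b \<union> ?s ` up_steps ?R z' b"
    proof cases
      case 1
      then show ?thesis using jump_in_up_steps[OF i _ _ z(3)] by blast
    next
      case 2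
      have "a < ?s i" "?s i < b" using i by auto
      from jump_in_up_steps[OF this 2 z'(3)] have "?s (?s i) \<in> ?s ` up_steps ?R z' b" by blast
      then show ?thesis by simp
    qed
  qed
  have fin: "finite ?X" "finite L" "finite (?s ` L')"
    using finite_subset[OF sub] finite_subset[OF sub'] by simp_all
  have apart: "h + h' \<le> b - a + 1" using h h' wide by linarith
  have thickL: "2 \<le> card (col W i)" if "i \<in> L" for i using thick L[OF that] by auto
  have thickL': "2 \<le> card (col W (?s i))" if "i \<in> L'" for i using thick'[of i] L'[OF that] by auto
  have d1: "?X \<inter> (L \<union> ?s ` L') = {}"
    using thickL thickL' unfolding singles_def by force
  have d2: "L \<inter> ?s ` L' = {}"
    using L L' apart by force
  have "card (?s ` L') = card L'" by (rule card_image) (auto simp: inj_on_def)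
  then have "card ?X + (card L + card L') = card (?X \<union> (L \<union> ?s ` L'))"
    using card_Un_disjoint[OF fin(1) _ d1] card_Un_disjoint[OF fin(2,3) d2] fin by auto
  also have "\<dots> \<le> card (up_steps W z b \<union> ?s ` up_steps ?R z' b)" using X sub sub' by (intro card_mono) auto
  also have "\<dots> \<le> card (up_steps W z b) + card (?s ` up_steps ?R z' b)" by (rule card_Un_le)
  also have "\<dots> \<le> card (up_steps W z b) + card (up_steps ?R z' b)" using card_image_le[of "up_steps ?R z' b" ?s] by simp
  finally have XL: "int (card ?X) + int (card L) + int (card L') \<le> int (card (up_steps W z b)) + int (card (up_steps ?R z' b))"
    by linarith
  let ?G = "{b-h<..b}" and ?G' = "{a..<a+h'}"
  have f3: "(\<Sum>i\<in>?G'. int (card (col W i)) - 2) = (\<Sum>i\<in>{b-h'<..b}. int (card (col ?R i)) - 2)"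
    by (rule sum.reindex_bij_witness[of _ ?s ?s]) auto
  have f2: "(\<Sum>i\<in>?G \<union> ?G'. int (card (col W i)) - 2)
      = (\<Sum>i\<in>?G. int (card (col W i)) - 2) + (\<Sum>i\<in>?G'. int (card (col W i)) - 2)"
    using apart by (intro sum.union_disjoint) auto
  have f1: "int (card {a..b}) - int (card ?X) + (\<Sum>i\<in>?G \<union> ?G'. int (card (col W i)) - 2) \<le> excess W {a..b}"
  proof (rule excess_lower[OF W])
    show "?G \<union> ?G' \<subseteq> {a..b}" using ah ah' by auto
    show "2 \<le> card (col W i)" if "i \<in> ?G \<union> ?G'" for i
      using that thick[of i] thick'[of "?s i"] by auto
  qed simp
  have f4: "int (card {a..b}) = b - a + 1" using ab by simp
  have f5: "spread m ?R b = spread m W a"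
    by (simp add: spread_def front_def col_def flip_def mirror_def)
  have f6: "front ?R b = front (flip m W) a" and f7: "front ?R a = front (flip m W) b" by simp_all
  have "m - 2 \<le> E" if "C - X + S \<le> E" "S = s + s''" "s'' = s'" "C = b - a + 1" "tb + fb - (m + 1) \<le> 2 * s + 2 + 2 * l"
      "r \<le> 2 * s' + 2 + 2 * l'" "r = ta + fa - (m + 1)" "2 * U + (m - ta) + (m - tb) \<le> b - a"
      "2 * U' + (m - ra) + (m - rb) \<le> b - a" "ra = fb" "rb = fa" "X + l + l' \<le> U + U'"
    for C X S E s s' s'' r ra rb ta fa tb fb l l' U U' :: int
    using that by linarith
  from this[OF f1 f2 f3 f4 sp[unfolded spread_def] sp' f5[unfolded spread_def[of m W]] z(5) z'(5) f7 f6 XL]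
  show ?thesis .
qed

section \<open>Zigzags and the classification of wide pieces\<close>

definition corner :: "int \<Rightarrow> (int \<times> int) set \<Rightarrow> int \<Rightarrow> bool" where
  "corner m W i \<longleftrightarrow> col W i = {1} \<or> col W i = {m}"

text \<open>The widths of \<open>k\<close> diagonal segments of \<open>m\<close> columns each, where consecutive segments are adjacent
  or share a column.\<close>

definition zigzag_width :: "int \<Rightarrow> int \<Rightarrow> bool" where
  "zigzag_width m w \<longleftrightarrow> (\<exists>k\<ge>1. k * (m - 1) + 1 \<le> w \<and> w \<le> k * m)"

text \<open>Column \<open>i\<close> of a zigzag that started in a corner of column \<open>a\<close>: after \<open>j\<close> segments, each of which took
  \<open>m - 1\<close> or \<open>m\<close> columns, the strand is in row \<open>k\<close> and moves up. For a strand that moves down the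
  flipped fort is rising. The last conjunct makes the next step up forced.\<close>

definition rising :: "int \<Rightarrow> int \<Rightarrow> (int \<times> int) set \<Rightarrow> int \<Rightarrow> int \<Rightarrow> int \<Rightarrow> bool" where
  "rising m a W i k j \<longleftrightarrow> 0 \<le> j \<and> j * (m - 1) + k \<le> i - a + 1 \<and> i - a + 1 \<le> j * m + k \<and>
     col W i = {k} \<and> (k < m \<longrightarrow> (i - 1, k + 1) \<notin> W)"

lemma corner_flip [simp]: "corner m (flip m W) i \<longleftrightarrow> corner m W i"
proof -
  have "corner m (flip m V) i" if "corner m V i" for V
    using that unfolding corner_def
  proof
    assume "col V i = {1}" then show "col (flip m V) i = {1} \<or> col (flip m V) i = {m}" by (simp add: col_flip)
  next
    assume "col V i = {m}" then show "col (flip m V) i = {1} \<or> col (flip m V) i = {m}" by (simp add: col_flip)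
  qed
  from this[of W] this[of "flip m W"] show ?thesis by (metis flip_flip)
qed

lemma col_single_iff: "col W i = {k} \<Longrightarrow> (i, j) \<in> W \<longleftrightarrow> j = k"
  by (metis in_col singleton_iff)

lemma reflect_image: "(\<lambda>i::int. c - i) ` S = {i. c - i \<in> S}"
proof (rule set_eqI)
  fix x
  show "x \<in> (\<lambda>i. c - i) ` S \<longleftrightarrow> x \<in> {i. c - i \<in> S}"
    using image_eqI[of x "\<lambda>i. c - i" "c - x" S] by auto
qed

lemma forced_right:
  assumes "fort m a b W" "a \<le> i" "i \<le> b" "col W i = {k}" "k < m" "(i - 1, k + 1) \<notin> W"
  shows "(i + 1, k + 1) \<in> W"
proof -
  have "(i, k) \<in> W" "(i, k + 1) \<notin> W" "(i, k + 2) \<notin> W" using col_single_iff[OF assms(4)] by auto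
  then show ?thesis
    using fort_down[OF assms(1-3), of "k + 1"] fort_grid(3)[OF assms(1), of i k] assms by (auto simp: add.assoc)
qed

lemma plainE:
  assumes "plain W i"
  obtains l where "col W i = {l}"
  using assms unfolding plain_def by blast

lemma rising_step:
  assumes W: "full_fort m a b W" and i: "a \<le> i" "i < b" and p: "plain W i" "plain W (i + 1)"
    and r: "rising m a W i k j"
  shows "(\<exists>k. rising m a W (i + 1) k j) \<or> (\<exists>k. rising m a (flip m W) (i + 1) k (j + 1))"
proof -
  note f = full_fortD(1)[OF W]
  have k: "col W i = {k}" using r by (simp add: rising_def)
  obtain k' where k': "col W (i + 1) = {k'}" using p(2) by (rule plainE)
  have kk: "\<bar>k' - k\<bar> \<le> 1" using plain_next[OF f _ _ p(1) k, of k'] i k' by (auto simp: col_def)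
  have g: "1 \<le> k" "k \<le> m" "k' \<le> m"
    using fort_grid[OF f, of i k] fort_grid[OF f, of "i + 1" k'] k k' by (auto simp: col_def)
  show ?thesis
  proof (cases "k < m")
    case True
    then have "(i + 1, k + 1) \<in> W" using forced_right[OF f _ _ k] r i by (auto simp: rising_def)
    then have "k' = k + 1" using k' by (auto simp: col_def)
    moreover have "(i, k + 1 + 1) \<notin> W" using col_single_iff[OF k] by auto
    ultimately have "rising m a W (i + 1) (k + 1) j" using r k' by (auto simp: rising_def)
    then show ?thesis by blast
  next
    case False
    then have km: "k = m" using g by simp
    let ?k = "m + 1 - k'"
    have "col (flip m W) (i + 1) = {?k}" using k' by (simp add: col_flip)
    moreover have "(i, ?k + 1) \<notin> flip m W" if "?k < m"
      using col_single_iff[OF k] km that kk g by auto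
    moreover have "j * (m - 1) + m \<le> i - a + 1" "i - a + 1 \<le> j * m + m" "0 \<le> j" using r km by (auto simp: rising_def)
    ultimately have "rising m a (flip m W) (i + 1) ?k (j + 1)"
      using kk km g by (auto simp: rising_def algebra_simps)
    then show ?thesis by blast
  qed
qed

lemma plain_run_rising:
  assumes W: "full_fort m a b W" and c: "corner m W a" and i: "a \<le> i" "i \<le> b"
    and p: "\<And>x. a \<le> x \<Longrightarrow> x \<le> i \<Longrightarrow> plain W x"
  shows "\<exists>V\<in>{W, flip m W}. \<exists>k j. rising m a V i k j"
  using i p
proof (induction i rule: int_ge_induct)
  case base
  have out: "(a - 1, x) \<notin> V" if "fort m a b V" for x V using fort_grid(1)[OF that] by force
  have "rising m a V a 1 0" if "fort m a b V" "col V a = {1}" for V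
    using that out by (auto simp: rising_def)
  moreover have "col (flip m W) a = {1}" if "col W a = {m}" using that by (simp add: col_flip)
  ultimately show ?case
    using c full_fortD(1)[OF W] fort_flip[OF full_fortD(1)[OF W]] unfolding corner_def by blast
next
  case (step i)
  then obtain V k j where V: "V = W \<or> V = flip m W" "rising m a V i k j" by auto
  have "full_fort m a b V" using V W full_fort_flip by blast
  moreover have "plain V i" "plain V (i + 1)" using V step by auto
  ultimately have "(\<exists>k. rising m a V (i + 1) k j) \<or> (\<exists>k. rising m a (flip m V) (i + 1) k (j + 1))"
    using rising_step V(2) step by auto
  then show ?case using V by auto
qed

lemma rising_end:
  assumes W: "full_fort m a b W" and r: "rising m a W b k j"
  shows "k = m" "zigzag_width m (b - a + 1)"
proof -
  note f = full_fortD[OF W]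
  have k: "col W b = {k}" using r by (simp add: rising_def)
  have "k \<le> m" using fort_grid(4)[OF f(1), of b k] k by (auto simp: col_def)
  moreover have "\<not> k < m"
  proof
    assume "k < m"
    then have "(b + 1, k + 1) \<in> W" using forced_right[OF f(1,2) _ k] r by (auto simp: rising_def)
    then show False using fort_grid(2)[OF f(1)] by force
  qed
  ultimately show km: "k = m" by simp
  have "1 \<le> j + 1 \<and> (j + 1) * (m - 1) + 1 \<le> b - a + 1 \<and> b - a + 1 \<le> (j + 1) * m"
    using r km by (auto simp: rising_def algebra_simps)
  then show "zigzag_width m (b - a + 1)" unfolding zigzag_width_def by blast
qed

text \<open>The vertices above and below \<open>k\<close> have nothing to their left, so each needs a white vertex to its right: a
  strand that starts at the wall outside of a corner forks at once.\<close>

lemma end_single_not_corner: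
  assumes W: "full_fort m a b W" and k: "col W a = {k}" and nc: "\<not> corner m W a"
  shows "1 < k" "k < m" "(a + 1, k + 1) \<in> W" "(a + 1, k - 1) \<in> W"
proof -
  note f = full_fortD[OF W]
  have "1 \<le> k" "k \<le> m" using fort_grid[OF f(1), of a k] k by (auto simp: col_def)
  then show kk: "1 < k" "k < m" using nc k by (auto simp: corner_def less_le)
  have out: "(a - 1, x) \<notin> V" if "fort m a b V" for x V using fort_grid(1)[OF that] by force
  show "(a + 1, k + 1) \<in> W" using forced_right[OF f(1) _ f(2) k kk(2) out[OF f(1)]] by simp
  have "(a + 1, m + 1 - k + 1) \<in> flip m W"
    using forced_right[OF fort_flip[OF f(1)] _ f(2), of "m + 1 - k"] k kk out[OF f(1)]
    by (simp add: col_flip)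
  then show "(a + 1, k - 1) \<in> W" by (simp add: algebra_simps)
qed

lemma all_plain_zigzag:
  assumes W: "full_fort m a b W" and p: "\<And>x. a \<le> x \<Longrightarrow> x \<le> b \<Longrightarrow> plain W x"
  shows "zigzag_width m (b - a + 1)" "corner m W a" "corner m W b"
proof -
  note f = full_fortD[OF W]
  show c: "corner m W a"
  proof (rule ccontr)
    assume nc: "\<not> corner m W a"
    have "plain W a" using p f(2) by simp
    then obtain k where k: "col W a = {k}" by (rule plainE)
    note n = end_single_not_corner[OF W k nc]
    have "a + 1 \<le> b" using fort_grid(2)[OF f(1) n(3)] .
    then have "plain W (a + 1)" using p by simp
    then obtain l where "col W (a + 1) = {l}" by (rule plainE)
    then have "k + 1 = l" "k - 1 = l" using n col_single_iff by blast+
    then show False by simp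
  qed
  obtain V k j where V: "V = W \<or> V = flip m W" "rising m a V b k j"
    using plain_run_rising[OF W c f(2) order_refl p] by auto
  have VF: "full_fort m a b V" using V W full_fort_flip by blast
  show "zigzag_width m (b - a + 1)" using rising_end[OF VF V(2)] by blast
  have "col V b = {m}" using rising_end(1)[OF VF V(2)] V(2) by (simp add: rising_def)
  then show "corner m W b" using V corner_flip[of m W b] by (auto simp: corner_def)
qed

text \<open>From a corner, the front has to cross all rows.\<close>

lemma corner_start_wide:
  assumes W: "full_fort m a b W" and c: "corner m W a"
  shows "m \<le> b - a + 1"
proof -
  have main: "m \<le> b - a + 1" if V: "full_fort m a b V" and k: "col V a = {1}" for V
  proof (cases "a < b")
    case True
    have "left_end a V a" "right_end b V b" by (auto simp: left_end_def right_end_def)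
    from front_profile[OF V order_refl True order_refl this]
    obtain z where "2 * int (card (up_steps V z b)) + (m - front V a) + (m - front V b) \<le> b - a" by metis
    moreover have "front V b \<le> m" using front_bounds(3)[OF V] True by auto
    ultimately show ?thesis using front_single[OF k] by linarith
  next
    case False
    then have "a = b" using full_fortD(2)[OF V] by simp
    moreover have "front V (a - 1) = 0" "front V (b + 1) = 0" using front_outside[OF full_fortD(1)[OF V]] by auto
    ultimately show ?thesis using front_grow[OF V, of a] front_single[OF k] by force
  qed
  have "col (flip m W) a = {1}" if "col W a = {m}" using that by (simp add: col_flip)
  then show ?thesis using c main[OF W] main[OF full_fort_flip[OF W]] by (auto simp: corner_def)
qed

lemma corner_end_wide:
  assumes W: "full_fort m a b W" and c: "corner m W b"
  shows "m \<le> b - a + 1"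
  using corner_start_wide[OF full_fort_mirror[OF W]] c by (simp add: corner_def)

lemma all_single_plain:
  assumes W: "full_fort m a b W" and s: "\<And>x. a \<le> x \<Longrightarrow> x \<le> b \<Longrightarrow> card (col W x) = 1"
    and i: "a \<le> i" "i \<le> b"
  shows "plain W i"
  using i
proof (induction i rule: int_ge_induct)
  case base
  obtain l where "col W a = {l}" using s[of a] base card_1_singletonE by blast
  then show ?case
    unfolding plain_def using fort_grid(1)[OF full_fortD(1)[OF W], of "a - 1"] by force
next
  case (step i)
  then have p: "plain W i" by simp
  obtain k where k: "col W i = {k}" using p by (rule plainE)
  obtain k' where k': "col W (i + 1) = {k'}" using s[of "i + 1"] step card_1_singletonE by (metis zle_add1_eq_le add_increasing2 order_trans le_add_same_cancel1 zero_le_one)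
  have "\<bar>k' - k\<bar> \<le> 1" using plain_next[OF full_fortD(1)[OF W] _ _ p k, of k'] k' step by (auto simp: col_def)
  then have "\<bar>t - k'\<bar> \<le> 1" if "(i + 1 - 1, t) \<in> W" for t
    using that col_single_iff[OF k] by auto
  then show ?case unfolding plain_def using k' by blast
qed

lemma excess_total:
  assumes "full_fort m a b W"
  shows "excess W {a..b} = int (card W) - (b - a + 1)"
proof -
  have "int (card {a..b}) = b - a + 1" using full_fortD(2)[OF assms] by simp
  then show ?thesis
    using card_fort_cols[OF full_fortD(1)[OF assms]] by (simp add: excess_def sum_subtractf)
qed

lemma excess_pos:
  assumes W: "full_fort m a b W" and i: "a \<le> i" "i \<le> b" and np: "\<not> plain W i"
  shows "1 \<le> excess W {a..b}"
proof -
  obtain x where x: "a \<le> x" "x \<le> b" "card (col W x) \<noteq> 1" using all_single_plain[OF W _ i] np by blast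
  then have "1 \<le> excess W {x}" using card_col_pos[OF W x(1,2)] by (simp add: excess_def)
  also have "\<dots> \<le> excess W {a..b}" using x by (intro excess_mono[OF W]) auto
  finally show ?thesis .
qed

text \<open>After the last plain column \<open>u\<close> of a rising strand the thick region extends to the wall. Either the upper
  front reaches the top in time for \<open>right_fan_excess\<close>, or it arrives exactly at the last column,
  as the undisturbed zigzag would have done.\<close>

lemma fork_excess:
  assumes W: "full_fort m a b W" and u: "a \<le> u" "u < b" and p: "plain W u"
    and np: "\<And>i. u < i \<Longrightarrow> i \<le> b \<Longrightarrow> \<not> plain W i"
    and k: "col W u = {k}" and r: "k < m \<Longrightarrow> (u - 1, k + 1) \<notin> W"
  shows "m - 2 \<le> excess W {u<..b} \<or> b - u = m - k"
proof -
  note f = full_fortD(1)[OF W]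
  have tu: "front W u = k" using front_single[OF k] .
  have e: "left_end a W u" "right_end b W b"
    using p np[of "u+1"] u by (auto simp: left_end_def right_end_def)
  obtain z where z: "u \<le> z" "z \<le> b" "front W z = m" "\<And>i. u \<le> i \<Longrightarrow> i < z \<Longrightarrow> front W i < m"
      "\<And>i. u < i \<Longrightarrow> i < z \<Longrightarrow> front W (i+1) = front W i + 1"
    using front_profile[OF W u(1,2) order_refl e] by metis
  show ?thesis
  proof (cases "z < b")
    case True
    then show ?thesis using right_fan_excess[OF W u p np z(1) _ z(3)] by blast
  next
    case False
    then have zb: "z = b" using z(2) by simp
    then have km: "k < m" using z(4)[of u] u tu by simp
    have "(u + 1, k + 1) \<in> W" using forced_right[OF f u(1) _ k km r[OF km]] u by simp
    then have "k + 1 \<le> front W (u + 1)" using front_ge[OF f] by blast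
    moreover have "front W (u + 1) \<le> k + 1" using front_left_end[OF W u e(1)] tu by simp
    ultimately have t1: "front W (u + 1) = k + 1" by simp
    have "front W i = k + (i - u)" if "u + 1 \<le> i" "i \<le> b" for i
      using that
    proof (induction i rule: int_ge_induct)
      case base then show ?case using t1 by simp
    next
      case (step i) then show ?case using z(5)[of i] zb by simp
    qed
    from this[of b] show ?thesis using z(3) zb u by simp
  qed
qed

text \<open>The second alternative of \<open>fork_excess\<close> means that the piece has the width of a zigzag, even
  though it is not one.\<close>

lemma plain_prefix_excess:
  assumes W: "full_fort m a b W" and wide: "m \<le> b - a + 1" and u: "a \<le> u" "u < b"
    and p: "\<And>i. a \<le> i \<Longrightarrow> i \<le> u \<Longrightarrow> plain W i"
    and np: "\<And>i. u < i \<Longrightarrow> i \<le> b \<Longrightarrow> \<not> plain W i"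
  shows "m - 1 \<le> 2 * excess W {a..b}" "zigzag_width m (b - a + 1) \<or> m - 2 \<le> excess W {a..b}"
proof -
  note f = full_fortD[OF W]
  have pu: "plain W u" using p u by simp
  have le: "excess W {u<..b} \<le> excess W {a..b}" using u by (intro excess_mono[OF W]) auto
  show "m - 1 \<le> 2 * excess W {a..b}" using right_half_excess[OF W u pu np] le by linarith
  show "zigzag_width m (b - a + 1) \<or> m - 2 \<le> excess W {a..b}"
  proof (cases "corner m W a")
    case True
    obtain V k j where V: "V = W \<or> V = flip m W" "rising m a V u k j"
      using plain_run_rising[OF W True u(1) _ p] u by auto
    have VF: "full_fort m a b V" using V W full_fort_flip by blast
    have ex: "excess V I = excess W I" for I using V by (auto simp: excess_def)
    have "m - 2 \<le> excess V {u<..b} \<or> b - u = m - k"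
      using V(2) V(1) np pu by (intro fork_excess[OF VF u]) (auto simp: rising_def)
    then show ?thesis
    proof
      assume "m - 2 \<le> excess V {u<..b}"
      then show ?thesis using ex le by simp
    next
      assume "b - u = m - k"
      then have "1 \<le> j + 1 \<and> (j + 1) * (m - 1) + 1 \<le> b - a + 1 \<and> b - a + 1 \<le> (j + 1) * m"
        using V(2) by (auto simp: rising_def algebra_simps)
      then show ?thesis unfolding zigzag_width_def by blast
    qed
  next
    case False
    have "plain W a" using p u by simp
    then obtain k where k: "col W a = {k}" by (rule plainE)
    note n = end_single_not_corner[OF W k False]
    have "u = a"
    proof (rule ccontr)
      assume "u \<noteq> a"
      then have "plain W (a + 1)" using p u by simp
      then obtain l where "col W (a + 1) = {l}" by (rule plainE)
      then have "k + 1 = l" "k - 1 = l" using n col_single_iff by blast+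
      then show False by simp
    qed
    moreover have "(a - 1, k + 1) \<notin> W" using fort_grid(1)[OF f(1)] by force
    ultimately have "m - 2 \<le> excess W {u<..b} \<or> b - u = m - k"
      using k by (intro fork_excess[OF W u pu np]) auto
    then show ?thesis using le wide n(1) \<open>u = a\<close> by auto
  qed
qed

text \<open>If a column that is not plain lies between two plain ones, there is a complete rectangle. Otherwise
  the plain columns form an interval, and each side on which it stops short of the wall contributes
  half a rectangle.\<close>

lemma wide_piece:
  assumes W: "full_fort m a b W" and wide: "m \<le> b - a + 1"
    and x: "a \<le> x" "x \<le> b" "\<not> plain W x"
  shows "m - 1 \<le> 2 * excess W {a..b}" "zigzag_width m (b - a + 1) \<or> m - 2 \<le> excess W {a..b}"
proof -
  let ?E = "excess W {a..b}"
  have pos: "1 \<le> ?E" using excess_pos[OF W x] .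
  have "m - 1 \<le> 2 * ?E \<and> (zigzag_width m (b - a + 1) \<or> m - 2 \<le> ?E)"
  proof (cases "\<exists>u v y. a \<le> u \<and> u < y \<and> y < v \<and> v \<le> b \<and> plain W u \<and> \<not> plain W y \<and> plain W v")
    case True
    then obtain u v y where y: "a \<le> u" "u < y" "y < v" "v \<le> b" "plain W u" "\<not> plain W y" "plain W v" by blast
    define u' where "u' = Max {i \<in> {a..<y}. plain W i}"
    define v' where "v' = Min {i \<in> {y<..b}. plain W i}"
    have F: "finite {i \<in> {a..<y}. plain W i}" "{i \<in> {a..<y}. plain W i} \<noteq> {}"
      "finite {i \<in> {y<..b}. plain W i}" "{i \<in> {y<..b}. plain W i} \<noteq> {}"
    proof -
      show "finite {i \<in> {a..<y}. plain W i}" by (rule finite_subset[of _ "{a..<y}"]) auto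
      show "finite {i \<in> {y<..b}. plain W i}" by (rule finite_subset[of _ "{y<..b}"]) auto
      have "u \<in> {i \<in> {a..<y}. plain W i}" using y by simp
      then show "{i \<in> {a..<y}. plain W i} \<noteq> {}" by blast
      have "v \<in> {i \<in> {y<..b}. plain W i}" using y by simp
      then show "{i \<in> {y<..b}. plain W i} \<noteq> {}" by blast
    qed
    have u': "a \<le> u'" "u' < y" "plain W u'" using Max_in[OF F(1,2)] unfolding u'_def by auto
    have v': "y < v'" "v' \<le> b" "plain W v'" using Min_in[OF F(3,4)] unfolding v'_def by auto
    have "\<not> plain W i" if "u' < i" "i < v'" for i
    proof
      assume i: "plain W i"
      consider "i < y" | "i = y" | "y < i" by linarith
      then show False
      proof cases
        case 1
        then have "i \<le> u'" unfolding u'_def using i that u' by (intro Max_ge[OF F(1)]) auto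
        then show False using that by simp
      next
        case 2 then show False using i y by simp
      next
        case 3
        then have "v' \<le> i" unfolding v'_def using i that v' by (intro Min_le[OF F(3)]) auto
        then show False using that by simp
      qed
    qed
    then have "m - 2 \<le> excess W {u'<..<v'}"
      using u' v' by (intro plain_gap_excess[OF W]) auto
    also have "\<dots> \<le> ?E" using u' v' by (intro excess_mono[OF W]) auto
    finally show ?thesis using pos by auto
  next
    case False
    have conv: "plain W y" if "a \<le> u" "u \<le> y" "y \<le> v" "v \<le> b" "plain W u" "plain W v" for u v y
    proof (rule ccontr)
      assume n: "\<not> plain W y"
      then have "u \<noteq> y" "y \<noteq> v" using that by auto
      then have "u < y" "y < v" using that by auto
      then show False using False that n by blast
    qed
    show ?thesis
    proof (cases "\<exists>u. a \<le> u \<and> u \<le> b \<and> plain W u")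
      case True
      define p where "p = Min {i \<in> {a..b}. plain W i}"
      define p' where "p' = Max {i \<in> {a..b}. plain W i}"
      have F: "finite {i \<in> {a..b}. plain W i}" "{i \<in> {a..b}. plain W i} \<noteq> {}"
      proof -
        show "finite {i \<in> {a..b}. plain W i}" by (rule finite_subset[of _ "{a..b}"]) auto
        show "{i \<in> {a..b}. plain W i} \<noteq> {}" using True by auto
      qed
      have p: "a \<le> p" "p \<le> b" "plain W p" using Min_in[OF F] unfolding p_def by auto
      have p': "a \<le> p'" "p' \<le> b" "plain W p'" using Max_in[OF F] unfolding p'_def by auto
      have before: "\<not> plain W i" if "a \<le> i" "i < p" for i
      proof
        assume "plain W i"
        then have "p \<le> i" unfolding p_def using that p by (intro Min_le[OF F(1)]) auto
        then show False using that by simp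
      qed
      have after: "\<not> plain W i" if "p' < i" "i \<le> b" for i
      proof
        assume "plain W i"
        then have "i \<le> p'" unfolding p'_def using that p' by (intro Max_ge[OF F(1)]) auto
        then show False using that by simp
      qed
      have pp: "p \<le> p'" using before[of p'] p' by force
      have between: "plain W i" if "p \<le> i" "i \<le> p'" for i using conv[of p i p'] that p p' by blast
      let ?M = "mirror a b W"
      have M: "full_fort m a b ?M" using full_fort_mirror[OF W] .
      have exM: "excess ?M I = excess W ((\<lambda>i. a + b - i) ` I)" for I
        unfolding excess_def by (subst sum.reindex) (auto simp: inj_on_def)
      have imM: "(\<lambda>i. a + b - i) ` {c<..b} = {a..<a + b - c}" for c
        unfolding reflect_image by auto
      have imF: "(\<lambda>i. a + b - i) ` {a..b} = {a..b}"
        unfolding reflect_image by auto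
      consider "p = a" "p' = b" | "p = a" "p' < b" | "a < p" "p' = b" | "a < p" "p' < b"
        using p p' by linarith
      then show ?thesis
      proof cases
        case 1
        then show ?thesis using between[of x] x by simp
      next
        case 2
        then show ?thesis using plain_prefix_excess[OF W wide p'(1) _ _ after] between by auto
      next
        case 3
        have "m - 1 \<le> 2 * excess ?M {a..b}" "zigzag_width m (b - a + 1) \<or> m - 2 \<le> excess ?M {a..b}"
          using plain_prefix_excess[OF M wide, of "a + b - p"] 3 p between before by auto
        then show ?thesis using exM imF by simp
      next
        case 4
        have "m - 1 \<le> 2 * excess W {p'<..b}" using right_half_excess[OF W p'(1) 4(2) p'(3) after] .
        moreover have "m - 1 \<le> 2 * excess ?M {a + b - p<..b}"
          using right_half_excess[OF M, of "a + b - p"] 4 p before by auto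
        then have "m - 1 \<le> 2 * excess W {a..<p}" using exM imM by simp
        moreover have "excess W {a..<p} + excess W {p'<..b} = excess W ({a..<p} \<union> {p'<..b})"
          unfolding excess_def using pp by (intro sum.union_disjoint[symmetric]) auto
        moreover have "excess W ({a..<p} \<union> {p'<..b}) \<le> ?E" using p p' by (intro excess_mono[OF W]) auto
        ultimately show ?thesis using pos by linarith
      qed
    next
      case False
      then have "m - 2 \<le> ?E" using excess_no_plain[OF W wide] by blast
      then show ?thesis using pos by auto
    qed
  qed
  then show "m - 1 \<le> 2 * excess W {a..b}" "zigzag_width m (b - a + 1) \<or> m - 2 \<le> excess W {a..b}" by auto
qed

section \<open>The lower bound for all forts\<close>

text \<open>The claimed value, with \<open>(r + 1) div 2\<close> for \<open>\<lceil>r / 2\<rceil>\<close>.\<close>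

definition target :: "int \<Rightarrow> int \<Rightarrow> int \<Rightarrow> int \<Rightarrow> int" where
  "target m n q r = (if r \<le> 2 * q then n - q + (r + 1) div 2 else n - q + m - 1)"

definition lower_bound :: "int \<Rightarrow> bool" where
  "lower_bound m \<longleftrightarrow> (\<forall>a b q r W. fort m a b W \<longrightarrow> W \<noteq> {} \<longrightarrow> m \<le> b - a + 1 \<longrightarrow>
     b - a + 1 - m = q * (m + 1) - r \<longrightarrow> 0 \<le> r \<longrightarrow> r \<le> m \<longrightarrow> target m (b - a + 1) q r \<le> int (card W))"

text \<open>A narrow piece is a grid with fewer rows than columns when transposed, so the lower bound for its
  width as the number of rows applies; \<open>q = m div (w + 1)\<close> and \<open>r\<close> are the parameters for that grid.\<close>

lemma narrow_piece:
  assumes W: "full_fort m a b W" and lt: "b - a + 1 < m" and lb: "lower_bound (b - a + 1)"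
  shows "m - 1 \<le> 2 * excess W {a..b}"
proof -
  define w where "w = b - a + 1"
  note f = full_fortD[OF W]
  let ?T = "{(j, i). (i + a - 1, j) \<in> W}"
  have T: "fort w 1 m ?T" using fort_transpose_shift[OF f(1)] by (simp add: w_def)
  have w1: "1 \<le> w" "w < m" using f(2) lt by (auto simp: w_def)
  have "?T = (\<lambda>(i, j). (j, i - a + 1)) ` W"
    by (auto simp: image_iff intro!: bexI[of _ "(_ + a - 1, _)"])
  moreover have "inj_on (\<lambda>(i::int, j::int). (j, i - a + 1)) W" by (auto simp: inj_on_def)
  ultimately have cT: "card ?T = card W" using card_image by metis
  have "card W \<noteq> 0"
    using card_col_pos[OF W order_refl f(2)] fort_finite[OF f(1)] f(3)[OF order_refl f(2)] by (auto simp: col_def)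
  then have neT: "?T \<noteq> {}" using cT by (metis card.empty)
  define q where "q = m div (w + 1)"
  define r where "r = q * (w + 1) - (m - w)"
  have "m = q * (w + 1) + m mod (w + 1)" unfolding q_def by (rule div_mult_mod_eq[symmetric])
  moreover have "0 \<le> m mod (w + 1)" "m mod (w + 1) < w + 1"
    using pos_mod_sign[of "w + 1" m] pos_mod_bound[of "w + 1" m] w1 by auto
  ultimately have r: "0 \<le> r" "r \<le> w" unfolding r_def by linarith+
  have eq: "m - w = q * (w + 1) - r" by (simp add: r_def)
  have "target w m q r \<le> int (card W)"
    using lb[unfolded lower_bound_def, folded w_def, rule_format, of 1 m ?T q r] T neT w1 eq r cT by simp
  moreover have ex: "excess W {a..b} = int (card W) - w" using excess_total[OF W] by (simp add: w_def)
  have q1: "1 \<le> q" unfolding q_def using w1 by (simp add: pos_imp_zdiv_pos_iff int_one_le_iff_zero_less)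
  show ?thesis
  proof (cases "r \<le> 2 * q")
    case True
    then have "2 * (m - q) + r \<le> 2 * int (card W)"
      using \<open>target w m q r \<le> int (card W)\<close> unfolding target_def by simp
    moreover have "0 \<le> (q - 1) * (w - 1)" using q1 w1 by simp
    then have "m - 1 \<le> 2 * (m - q) + r - 2 * w" using eq by (simp add: algebra_simps)
    ultimately show ?thesis using ex by simp
  next
    case False
    then show ?thesis using \<open>target w m q r \<le> int (card W)\<close> ex r w1 unfolding target_def by simp
  qed
qed

lemma empty_cols_propagate:
  assumes W: "fort m a b W" and i: "a - 1 \<le> i" and e: "col W i = {}" "col W (i + 1) = {}" and k: "i \<le> k"
  shows "col W k = {} \<and> col W (k + 1) = {}"
  using k
proof (induction k rule: int_ge_induct)
  case base then show ?case using e by simp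
next
  case (step k)
  then have n: "(k, j) \<notin> W" "(k + 1, j) \<notin> W" for j by (auto simp: col_def)
  have "(k + 2, j) \<notin> W" for j
  proof
    assume j: "(k + 2, j) \<in> W"
    then show False
      using fort_right[OF W, of "k + 1" j] fort_grid[OF W j] step i n by (auto simp: add.assoc)
  qed
  then show ?case using step by (auto simp: col_def add.assoc)
qed

text \<open>Two adjacent empty columns force the next column to be empty, in both directions. Applied
  to the columns just outside the grid this shows that a nonempty fort has no empty column at its ends.\<close>

lemma consecutive_empty_cols:
  assumes W: "fort m a b W" and i: "a - 1 \<le> i" "i \<le> b" and e: "col W i = {}" "col W (i + 1) = {}"
  shows "W = {}"
proof -
  have "(k, j) \<notin> W" for k j
  proof (cases "i \<le> k")
    case True
    then show ?thesis using empty_cols_propagate[OF W i(1) e] by (auto simp: col_def)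
  next
    case False
    have "col (mirror a b W) (a + b - k) = {}"
      using empty_cols_propagate[OF fort_mirror[OF W], of "a + b - i - 1" "a + b - k"] i e False by simp
    then show ?thesis by (auto simp: col_def)
  qed
  then show ?thesis by auto
qed

lemma first_col_nonempty:
  assumes "fort m a b W" "W \<noteq> {}" "a \<le> b"
  shows "col W a \<noteq> {}"
proof
  assume "col W a = {}"
  moreover have "col W (a - 1) = {}" using col_outside[OF assms(1)] by simp
  ultimately show False using consecutive_empty_cols[OF assms(1), of "a - 1"] assms by auto
qed

lemma last_col_nonempty:
  assumes "fort m a b W" "W \<noteq> {}" "a \<le> b"
  shows "col W b \<noteq> {}"
proof
  assume "col W b = {}"
  moreover have "col W (b + 1) = {}" using col_outside[OF assms(1)] by simp
  ultimately show False using consecutive_empty_cols[OF assms(1), of b] assms by auto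
qed

lemma fort_left_part:
  assumes W: "fort m a b W" and e: "a \<le> e" "e \<le> b" "col W e = {}"
  shows "fort m a (e - 1) {(i, j) \<in> W. i < e}" (is "fort _ _ _ ?P")
proof (rule fortI)
  show "?P \<subseteq> {a..e - 1} \<times> {1..m}" using fort_grid[OF W] by force
  fix i j assume ij: "a \<le> i" "i \<le> e - 1" "1 \<le> j" "j \<le> m" "(i, j) \<notin> ?P"
  then have *: "a \<le> i" "i \<le> b" "1 \<le> j" "j \<le> m" "(i, j) \<notin> W" using e by auto
  have P: "(x, y) \<in> ?P \<longleftrightarrow> (x, y) \<in> W" if "x \<le> e" for x y
    using that e(3) by (auto simp: col_def less_le)
  show "balanced ?P i j"
    unfolding balanced_def using fort_other[OF W *] P[of "i - 1"] P[of i] P[of "i + 1"] ij(2) by auto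
qed

lemma fort_right_part:
  assumes W: "fort m a b W" and e: "a \<le> e" "e \<le> b" "col W e = {}"
  shows "fort m (e + 1) b {(i, j) \<in> W. e < i}" (is "fort _ _ _ ?P")
proof (rule fortI)
  show "?P \<subseteq> {e + 1..b} \<times> {1..m}" using fort_grid[OF W] by force
  fix i j assume ij: "e + 1 \<le> i" "i \<le> b" "1 \<le> j" "j \<le> m" "(i, j) \<notin> ?P"
  then have *: "a \<le> i" "i \<le> b" "1 \<le> j" "j \<le> m" "(i, j) \<notin> W" using e by auto
  have P: "(x, y) \<in> ?P \<longleftrightarrow> (x, y) \<in> W" if "e \<le> x" for x y
    using that e(3) by (auto simp: col_def less_le)
  show "balanced ?P i j"
    unfolding balanced_def using fort_other[OF W *] P[of "i - 1"] P[of i] P[of "i + 1"] ij(1) by auto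
qed

text \<open>An empty column is a mirror: its vertices see white vertices only to the left and to the right.\<close>

lemma empty_col_mirror:
  assumes W: "fort m a b W" and e: "a \<le> e" "e \<le> b" "col W e = {}"
  shows "col W (e - 1) = col W (e + 1)"
proof -
  have n: "(e, j) \<notin> W" for j using e(3) by (auto simp: col_def)
  have "(e - 1, j) \<in> W \<longleftrightarrow> (e + 1, j) \<in> W" for j
  proof
    assume j: "(e - 1, j) \<in> W"
    show "(e + 1, j) \<in> W" using fort_left[OF W e(1,2) _ _ n j] fort_grid(3,4)[OF W j] n by blast
  next
    assume j: "(e + 1, j) \<in> W"
    show "(e - 1, j) \<in> W" using fort_right[OF W e(1,2) _ _ n j] fort_grid(3,4)[OF W j] n by blast
  qed
  then show ?thesis by (auto simp: col_def)
qed

text \<open>The parameters of \<open>s\<close> zigzags with \<open>K\<close> segments in total, of which \<open>C\<close> pairs share a column. Here and below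
  a piece of width \<open>w\<close> is given length \<open>w + 1\<close>, including the empty column after it, so that lengths add up; the
  total length is \<open>n + 1\<close>.\<close>

definition zig_profile :: "int \<Rightarrow> int \<Rightarrow> int \<Rightarrow> int \<Rightarrow> int \<Rightarrow> bool" where
  "zig_profile m K C s l \<longleftrightarrow> 0 \<le> s \<and> 0 \<le> C \<and> C \<le> K - s \<and> l = K * m - C + s \<and> (s = 0 \<longrightarrow> K = 0)"

lemma zig_profile_add:
  "zig_profile m K C s l \<Longrightarrow> zig_profile m K' C' s' l' \<Longrightarrow> zig_profile m (K + K') (C + C') (s + s') (l + l')"
  unfolding zig_profile_def by (auto simp: algebra_simps)

lemma zig_profile_zero: "zig_profile m 0 0 0 0"
  by (simp add: zig_profile_def)

lemma zigzag_width_profile: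
  assumes "zigzag_width m w"
  obtains K C where "zig_profile m K C 1 (w + 1)"
proof -
  obtain k where k: "1 \<le> k" "k * (m - 1) + 1 \<le> w" "w \<le> k * m" using assms unfolding zigzag_width_def by blast
  then have "zig_profile m k (k * m - w) 1 (w + 1)" unfolding zig_profile_def by (auto simp: algebra_simps)
  then show thesis by (rule that)
qed

lemma zig_profile_ge:
  assumes "zig_profile m K C s l" "1 \<le> m"
  shows "s * (m + 1) \<le> l"
proof -
  have "(s + C) * m \<le> K * m" using assms unfolding zig_profile_def by (intro mult_right_mono) auto
  moreover have "C \<le> C * m" using assms mult_left_mono[of 1 m C] unfolding zig_profile_def by auto
  ultimately show ?thesis using assms unfolding zig_profile_def by (auto simp: algebra_simps)
qed

text \<open>If zigzags alone fill the grid, then at least \<open>q + 1\<close> segments are needed to reach the length. With \<open>C \<le> K - s\<close>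
  the length is at least \<open>K (m - 1) + 2 s\<close>, which limits the number \<open>s - 1\<close> of empty columns.\<close>

lemma zig_profile_bound:
  assumes z: "zig_profile m K C s ((q + 1) * (m + 1) - r)" and s: "1 \<le> s" and r: "r \<le> m" and m: "1 \<le> m"
  shows "2 * s \<le> 2 * (q + 1) - r"
proof -
  have e: "0 \<le> C" "C \<le> K - s" "(q + 1) * (m + 1) - r = K * m - C + s" using z by (auto simp: zig_profile_def)
  have Kq: "q + 1 \<le> K"
  proof (rule ccontr)
    assume "\<not> q + 1 \<le> K"
    then have "K * (m + 1) \<le> q * (m + 1)" using m by (intro mult_right_mono) auto
    then show False using e r by (auto simp: algebra_simps)
  qed
  have "(q + 1) * (m - 1) \<le> K * (m - 1)" using Kq m by (intro mult_right_mono) auto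
  then show ?thesis using e by (auto simp: algebra_simps)
qed

text \<open>What is known about the width \<open>w\<close> and the excess \<open>x\<close> of a piece that is not a zigzag.\<close>

definition thick_width :: "int \<Rightarrow> int \<Rightarrow> int \<Rightarrow> bool" where
  "thick_width m w x \<longleftrightarrow> 1 \<le> w \<and> 1 \<le> x \<and> m - 1 \<le> 2 * x \<and> (m \<le> w \<longrightarrow> zigzag_width m w \<or> m - 2 \<le> x)"

lemma piece_dichotomy:
  assumes W: "full_fort m a b W" and m: "1 \<le> m" and lb: "b - a + 1 < m \<Longrightarrow> lower_bound (b - a + 1)"
  shows "zigzag_width m (b - a + 1) \<and> corner m W a \<and> int (card W) = b - a + 1 \<or>
    thick_width m (b - a + 1) (int (card W) - (b - a + 1)) \<and> (corner m W a \<or> corner m W b \<longrightarrow> m \<le> b - a + 1)"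
proof (cases "\<forall>x. a \<le> x \<and> x \<le> b \<longrightarrow> plain W x")
  case True
  have "card (col W i) = 1" if "i \<in> {a..b}" for i
  proof -
    have "plain W i" using True that by simp
    then obtain l where "col W i = {l}" by (rule plainE)
    then show ?thesis by simp
  qed
  then have "excess W {a..b} = 0" unfolding excess_def by simp
  then show ?thesis using all_plain_zigzag[OF W] True excess_total[OF W] by auto
next
  case False
  then obtain x where x: "a \<le> x" "x \<le> b" "\<not> plain W x" by blast
  have "thick_width m (b - a + 1) (excess W {a..b})"
  proof (cases "m \<le> b - a + 1")
    case True
    then show ?thesis using wide_piece[OF W True x] excess_pos[OF W x] full_fortD(2)[OF W] unfolding thick_width_def by auto
  next
    case False
    then show ?thesis
      using narrow_piece[OF W _ lb] excess_pos[OF W x] full_fortD(2)[OF W] unfolding thick_width_def by auto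
  qed
  then show ?thesis using excess_total[OF W] corner_start_wide[OF W] corner_end_wide[OF W] by auto
qed

text \<open>What remains to be known of a fort of length \<open>l\<close> with \<open>c\<close> vertices, where \<open>cn\<close> says that it starts with a corner:
  the pieces are all zigzags; or exactly one is not; or at least two are not, of total length \<open>y\<close> and total excess at
  least \<open>z\<close> above one each. In every case \<open>s\<close> is the number of zigzags. A piece next to a zigzag begins or
  ends in a corner and therefore is wide, which is recorded as an implication.\<close>

definition summary :: "int \<Rightarrow> int \<Rightarrow> int \<Rightarrow> bool \<Rightarrow> bool" where
  "summary m l c cn \<longleftrightarrow>
     (\<exists>K C s. zig_profile m K C s l \<and> 1 \<le> s \<and> c = l - s \<and> cn) \<or>
     (\<exists>K C s w x. zig_profile m K C s (l - (w + 1)) \<and> thick_width m w x \<and> c = l - s + x - 1 \<and> (1 \<le> s \<or> cn \<longrightarrow> m \<le> w)) \<or>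
     (\<exists>s y z. 0 \<le> s \<and> s * (m + 1) + y \<le> l \<and> 1 \<le> y \<and> (1 \<le> s \<or> cn \<longrightarrow> m + 1 \<le> y) \<and>
        0 \<le> z \<and> m - 3 \<le> z \<and> l - s + z \<le> c)"

lemma summary_zigzag:
  assumes z: "zigzag_width m w" and m: "1 \<le> m" and S: "summary m l c True"
  shows "summary m (w + 1 + l) (w + c) True"
proof -
  obtain K C where Z: "zig_profile m K C 1 (w + 1)" using z by (rule zigzag_width_profile)
  from S consider K' C' s where "zig_profile m K' C' s l" "1 \<le> s" "c = l - s"
    | K' C' s w' x where "zig_profile m K' C' s (l - (w' + 1))" "thick_width m w' x" "c = l - s + x - 1" "m \<le> w'"
    | s y z where "0 \<le> s" "s * (m + 1) + y \<le> l" "m + 1 \<le> y" "0 \<le> z" "m - 3 \<le> z" "l - s + z \<le> c"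
    unfolding summary_def by blast
  then show ?thesis
  proof cases
    case 1
    then have "zig_profile m (K + K') (C + C') (1 + s) (w + 1 + l) \<and> 1 \<le> 1 + s \<and> w + c = w + 1 + l - (1 + s) \<and> True"
      using zig_profile_add[OF Z 1(1)] by simp
    then show ?thesis unfolding summary_def by blast
  next
    case 2
    have "w + 1 + (l - (w' + 1)) = w + 1 + l - (w' + 1)" by simp
    then have "zig_profile m (K + K') (C + C') (1 + s) (w + 1 + l - (w' + 1)) \<and> thick_width m w' x \<and>
      w + c = w + 1 + l - (1 + s) + x - 1 \<and> (1 \<le> 1 + s \<or> True \<longrightarrow> m \<le> w')"
      using zig_profile_add[OF Z 2(1)] 2 by simp
    then show ?thesis unfolding summary_def by blast
  next
    case 3
    have "m + 1 \<le> w + 1" using zig_profile_ge[OF Z m] by simp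
    then have "0 \<le> 1 + s \<and> (1 + s) * (m + 1) + y \<le> w + 1 + l \<and> 1 \<le> y \<and> (1 \<le> 1 + s \<or> True \<longrightarrow> m + 1 \<le> y) \<and>
        0 \<le> z \<and> m - 3 \<le> z \<and> w + 1 + l - (1 + s) + z \<le> w + c"
      using 3 m by (auto simp: algebra_simps)
    then show ?thesis unfolding summary_def by blast
  qed
qed

lemma summary_thick:
  assumes t: "thick_width m w x" and m: "1 \<le> m" and S: "summary m l c cr"
    and cn: "cn \<or> cr \<Longrightarrow> m \<le> w"
  shows "summary m (w + 1 + l) (w + x + c) cn"
proof -
  have t': "1 \<le> w" "1 \<le> x" "m - 1 \<le> 2 * x" using t by (auto simp: thick_width_def)
  from S consider K s C where "zig_profile m K C s l" "1 \<le> s" "c = l - s" "cr"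
    | K C s w' x' where "zig_profile m K C s (l - (w' + 1))" "thick_width m w' x'" "c = l - s + x' - 1" "1 \<le> s \<or> cr \<longrightarrow> m \<le> w'"
    | s y z where "0 \<le> s" "s * (m + 1) + y \<le> l" "1 \<le> y" "1 \<le> s \<or> cr \<longrightarrow> m + 1 \<le> y" "0 \<le> z" "m - 3 \<le> z" "l - s + z \<le> c"
    unfolding summary_def by blast
  then show ?thesis
  proof cases
    case 1
    then have "zig_profile m K C s (w + 1 + l - (w + 1)) \<and> thick_width m w x \<and>
      w + x + c = w + 1 + l - s + x - 1 \<and> (1 \<le> s \<or> cn \<longrightarrow> m \<le> w)"
      using t cn by simp
    then show ?thesis unfolding summary_def by blast
  next
    case 2
    have "1 \<le> w'" "1 \<le> x'" "m - 1 \<le> 2 * x'" using 2 by (auto simp: thick_width_def)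
    moreover have "s * (m + 1) \<le> l - (w' + 1)" "0 \<le> s" using zig_profile_ge[OF 2(1) m] 2(1) by (auto simp: zig_profile_def)
    ultimately have "0 \<le> s \<and> s * (m + 1) + (w + 1 + (w' + 1)) \<le> w + 1 + l \<and> 1 \<le> w + 1 + (w' + 1) \<and>
      (1 \<le> s \<or> cn \<longrightarrow> m + 1 \<le> w + 1 + (w' + 1)) \<and> 0 \<le> x + x' - 2 \<and> m - 3 \<le> x + x' - 2 \<and>
      w + 1 + l - s + (x + x' - 2) \<le> w + x + c"
      using 2 t' cn by auto
    then show ?thesis unfolding summary_def by blast
  next
    case 3
    then have "0 \<le> s \<and> s * (m + 1) + (w + 1 + y) \<le> w + 1 + l \<and> 1 \<le> w + 1 + y \<and>
      (1 \<le> s \<or> cn \<longrightarrow> m + 1 \<le> w + 1 + y) \<and> 0 \<le> x - 1 + z \<and> m - 3 \<le> x - 1 + z \<and>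
      w + 1 + l - s + (x - 1 + z) \<le> w + x + c"
      using t' cn by auto
    then show ?thesis unfolding summary_def by blast
  qed
qed

lemma fort_summary:
  assumes m: "1 \<le> m" and lb: "\<And>w. 1 \<le> w \<Longrightarrow> w < m \<Longrightarrow> lower_bound w"
    and W: "fort m a b W" "W \<noteq> {}" "a \<le> b"
  shows "summary m (b - a + 2) (int (card W)) (corner m W a)"
  using W
proof (induction "nat (b - a)" arbitrary: a W rule: less_induct)
  case less
  show ?case
  proof (cases "\<forall>i. a \<le> i \<and> i \<le> b \<longrightarrow> col W i \<noteq> {}")
    case True
    then have F: "full_fort m a b W" using less.prems by (auto simp: full_fort_def)
    let ?w = "b - a + 1"
    consider "zigzag_width m ?w" "corner m W a" "int (card W) = ?w"
      | "thick_width m ?w (int (card W) - ?w)" "corner m W a \<longrightarrow> m \<le> ?w"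
      using piece_dichotomy[OF F m lb] less.prems by auto
    then show ?thesis
    proof cases
      case 1
      obtain K C where "zig_profile m K C 1 (?w + 1)" using 1(1) by (rule zigzag_width_profile)
      then have "zig_profile m K C 1 (b - a + 2) \<and> 1 \<le> (1::int) \<and> int (card W) = b - a + 2 - 1 \<and> corner m W a"
        using 1 by (simp add: algebra_simps)
      then show ?thesis unfolding summary_def by blast
    next
      case 2
      then have "zig_profile m 0 0 0 (b - a + 2 - (?w + 1)) \<and> thick_width m ?w (int (card W) - ?w) \<and>
         int (card W) = b - a + 2 - 0 + (int (card W) - ?w) - 1 \<and> (1 \<le> (0::int) \<or> corner m W a \<longrightarrow> m \<le> ?w)"
        using zig_profile_zero by simp
      then show ?thesis unfolding summary_def by blast
    qed
  next
    case False
    define e where "e = Min {i \<in> {a..b}. col W i = {}}"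
    have fin: "finite {i \<in> {a..b}. col W i = {}}" by (rule finite_subset[of _ "{a..b}"]) auto
    moreover have "{i \<in> {a..b}. col W i = {}} \<noteq> {}" using False by auto
    ultimately have "e \<in> {i \<in> {a..b}. col W i = {}}" unfolding e_def by (rule Min_in)
    then have e: "a \<le> e" "e \<le> b" "col W e = {}" by auto
    have "e \<noteq> a" "e \<noteq> b"
      using e first_col_nonempty[OF less.prems] last_col_nonempty[OF less.prems] by auto
    then have ab: "a < e" "e < b" using e by auto
    have before: "col W i \<noteq> {}" if "a \<le> i" "i < e" for i
    proof
      assume "col W i = {}"
      then have "e \<le> i" unfolding e_def using that e by (intro Min_le[OF fin]) auto
      then show False using that by simp
    qed
    let ?P = "{(i, j) \<in> W. i < e}" and ?R = "{(i, j) \<in> W. e < i}"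
    have P: "fort m a (e - 1) ?P" and R: "fort m (e + 1) b ?R"
      using fort_left_part[OF less.prems(1) e] fort_right_part[OF less.prems(1) e] .
    have colP: "col ?P i = col W i" if "i < e" for i using that by (auto simp: col_def)
    have colR: "col ?R i = col W i" if "e < i" for i using that by (auto simp: col_def)
    have FP: "full_fort m a (e - 1) ?P" unfolding full_fort_def using P ab before colP by auto
    have "col W (e + 1) \<noteq> {}"
      using consecutive_empty_cols[OF less.prems(1), of e] e less.prems(2) by auto
    then have Rne: "?R \<noteq> {}" by (auto simp: col_def)
    have "x \<noteq> e" if "(x, y) \<in> W" for x y using that e(3) by (auto simp: col_def)
    then have "W = ?P \<union> ?R" by (force simp: neq_iff)
    then have "card W = card (?P \<union> ?R)" by simp
    also have "\<dots> = card ?P + card ?R"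
      by (rule card_Un_disjoint) (use fort_finite[OF P] fort_finite[OF R] in auto)
    finally have cW: "int (card W) = int (card ?P) + int (card ?R)" by simp
    have IH: "summary m (b - (e + 1) + 2) (int (card ?R)) (corner m ?R (e + 1))"
      using less.hyps[of "e + 1" ?R] R Rne ab by auto
    have c1: "corner m ?P a \<longleftrightarrow> corner m W a" using colP[of a] ab by (simp add: corner_def)
    have c2: "corner m ?P (e - 1) \<longleftrightarrow> corner m ?R (e + 1)"
      using colP[of "e - 1"] colR[of "e + 1"] empty_col_mirror[OF less.prems(1) e] by (simp add: corner_def)
    let ?w = "e - 1 - a + 1"
    have len: "?w + 1 + (b - (e + 1) + 2) = b - a + 2" by simp
    consider "\<forall>x. a \<le> x \<and> x \<le> e - 1 \<longrightarrow> plain ?P x"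
      | x where "a \<le> x" "x \<le> e - 1" "\<not> plain ?P x" by blast
    then show ?thesis
    proof cases
      case 1
      then have Z: "zigzag_width m ?w" "corner m ?P a" "corner m ?P (e - 1)"
        using all_plain_zigzag[OF FP] by auto
      have "excess ?P {a..e - 1} = 0"
        unfolding excess_def
      proof (rule sum.neutral, rule ballI)
        fix i assume "i \<in> {a..e - 1}"
        then have "plain ?P i" using 1 by simp
        then obtain l where "col ?P i = {l}" by (rule plainE)
        then show "int (card (col ?P i)) - 1 = 0" by simp
      qed
      then have "int (card ?P) = ?w" using excess_total[OF FP] by simp
      moreover have "corner m ?R (e + 1) = True" using Z(3) c2 by simp
      then have "summary m (b - (e + 1) + 2) (int (card ?R)) True" using IH by (simp only:)
      then have "summary m (?w + 1 + (b - (e + 1) + 2)) (?w + int (card ?R)) True"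
        by (rule summary_zigzag[OF Z(1) m])
      then have "summary m (b - a + 2) (?w + int (card ?R)) True" by (simp only: len)
      moreover have "corner m W a = True" using Z(2) c1 by simp
      ultimately show ?thesis using cW by simp
    next
      case 2
      have D: "thick_width m ?w (int (card ?P) - ?w)" "corner m ?P a \<or> corner m ?P (e - 1) \<longrightarrow> m \<le> ?w"
      proof -
        have "int (card ?P) \<noteq> ?w" using excess_pos[OF FP 2] excess_total[OF FP] by simp
        then show "thick_width m ?w (int (card ?P) - ?w)" "corner m ?P a \<or> corner m ?P (e - 1) \<longrightarrow> m \<le> ?w"
          using piece_dichotomy[OF FP m lb] ab by auto
      qed
      have "summary m (?w + 1 + (b - (e + 1) + 2)) (?w + (int (card ?P) - ?w) + int (card ?R)) (corner m W a)"
        using D c1 c2 by (intro summary_thick[OF D(1) m IH]) blast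
      then have "summary m (b - a + 2) (?w + (int (card ?P) - ?w) + int (card ?R)) (corner m W a)"
        by (simp only: len)
      moreover have "?w + (int (card ?P) - ?w) + int (card ?R) = int (card W)" using cW by simp
      ultimately show ?thesis by (simp only:)
    qed
  qed
qed

text \<open>The number of vertices is \<open>n + 1 - s\<close> plus the sum of \<open>x - 1\<close> over the pieces that are not zigzags, so with
  \<open>p = q + 1 - s\<close> the claim is that this sum plus \<open>p\<close> is at least \<open>\<lceil>r/2\<rceil>\<close> or \<open>m - 1\<close>. If there are
  pieces that are not zigzags, the length leaves \<open>p \<ge> 1\<close>, and \<open>p = 1\<close> only if \<open>r = 0\<close>. For \<open>p \<ge> 2\<close> two
  such pieces have enough excess, and so has a single one, unless \<open>r > 2 q\<close> and it has the width of a
  zigzag; but then the total length would be that of zigzags, contradicting \<open>zig_profile_bound\<close>.\<close>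

lemma summary_target:
  assumes S: "summary m (n + 1) c cn" and m: "1 \<le> m" "m \<le> n" and n: "n - m = q * (m + 1) - r" and r: "0 \<le> r" "r \<le> m"
  shows "target m n q r \<le> c"
proof -
  have l: "n + 1 = (q + 1) * (m + 1) - r" using n by (simp add: algebra_simps)
  have "0 \<le> q * (m + 1)" using n m r by linarith
  then have q0: "0 \<le> q" using m by (simp add: zero_le_mult_iff)
  have two: "(q + 1 - s) * (m + 1) - r \<ge> y \<Longrightarrow> 1 \<le> y \<Longrightarrow> 1 \<le> q + 1 - s" for s y
  proof (rule ccontr)
    assume "(q + 1 - s) * (m + 1) - r \<ge> y" "1 \<le> y" "\<not> 1 \<le> q + 1 - s"
    moreover from this have "(q + 1 - s) * (m + 1) \<le> 0 * (m + 1)" using m by (intro mult_right_mono) auto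
    ultimately show False using r by simp
  qed
  have zero: "r = 0" if "s = q" "0 \<le> s" "(q + 1 - s) * (m + 1) - r \<ge> y" "1 \<le> s \<longrightarrow> m + 1 \<le> y" for s y
  proof (cases "1 \<le> s")
    case True then show ?thesis using that r by (simp add: algebra_simps)
  next
    case False
    then have "q = 0" using that by simp
    then show ?thesis using n m r by simp
  qed
  have t0: "target m n q 0 = n - q" using q0 by (simp add: target_def)
  have tle: "target m n q r \<le> n - q + max (m - 1) 1" using r unfolding target_def by auto
  from S consider K C s where "zig_profile m K C s (n + 1)" "1 \<le> s" "c = n + 1 - s"
    | K C s w x where "zig_profile m K C s (n + 1 - (w + 1))" "thick_width m w x" "c = n + 1 - s + x - 1" "1 \<le> s \<longrightarrow> m \<le> w"
    | s y z where "0 \<le> s" "s * (m + 1) + y \<le> n + 1" "1 \<le> y" "1 \<le> s \<longrightarrow> m + 1 \<le> y" "0 \<le> z" "m - 3 \<le> z" "n + 1 - s + z \<le> c"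
    unfolding summary_def by blast
  then show ?thesis
  proof cases
    case 1
    have "2 * s \<le> 2 * (q + 1) - r" using zig_profile_bound[of m K C s q r] 1 l r m by simp
    then show ?thesis using 1 unfolding target_def by auto
  next
    case 2
    have w: "1 \<le> w" "1 \<le> x" "m - 1 \<le> 2 * x" using 2 by (auto simp: thick_width_def)
    have s0: "0 \<le> s" using 2 by (simp add: zig_profile_def)
    have "s * (m + 1) \<le> n - w" using zig_profile_ge[OF 2(1) m(1)] by simp
    then have y: "(q + 1 - s) * (m + 1) - r \<ge> w + 1" using l by (simp add: algebra_simps)
    have p1: "1 \<le> q + 1 - s" using two[OF y] w by simp
    show ?thesis
    proof (cases "s = q")
      case True
      then have "r = 0" using zero[OF True s0 y] 2(4) by simp
      then show ?thesis using t0 True 2(3) w by simp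
    next
      case False
      then have p2: "2 \<le> q + 1 - s" using p1 by simp
      show ?thesis
      proof (cases "r \<le> 2 * q")
        case True
        then show ?thesis using 2(3) w p2 r unfolding target_def by auto
      next
        case rq: False
        have wm: "m \<le> w"
        proof (cases "1 \<le> s")
          case True then show ?thesis using 2(4) by simp
        next
          case False
          then have "s = 0" using s0 by simp
          then have "n + 1 - (w + 1) = 0" using 2(1) by (auto simp: zig_profile_def)
          then show ?thesis using m by simp
        qed
        have "\<not> zigzag_width m w"
        proof
          assume "zigzag_width m w"
          then obtain K' C' where "zig_profile m K' C' 1 (w + 1)" by (rule zigzag_width_profile)
          from zig_profile_add[OF 2(1) this]
          have "zig_profile m (K + K') (C + C') (s + 1) ((q + 1) * (m + 1) - r)" using l by simp
          from zig_profile_bound[OF this _ r(2) m(1)] s0 have "2 * (s + 1) \<le> 2 * (q + 1) - r" by simp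
          then show False using rq s0 by simp
        qed
        then have "m - 2 \<le> x" using 2(2) wm by (simp add: thick_width_def)
        then show ?thesis using rq 2(3) p2 unfolding target_def by simp
      qed
    qed
  next
    case 3
    have y: "(q + 1 - s) * (m + 1) - r \<ge> y" using 3(2) l by (simp add: algebra_simps)
    have p1: "1 \<le> q + 1 - s" using two[OF y 3(3)] .
    show ?thesis
    proof (cases "s = q")
      case True
      then have "r = 0" using zero[OF True 3(1) y 3(4)] by simp
      then show ?thesis using t0 True 3 by simp
    next
      case False
      then have p2: "2 \<le> q + 1 - s" using p1 by simp
      then show ?thesis using tle 3 by simp
    qed
  qed
qed

lemma lower_bound_all:
  assumes "1 \<le> m"
  shows "lower_bound m"
  using assms
proof (induction "nat m" arbitrary: m rule: less_induct)
  case less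
  have lb: "lower_bound w" if "1 \<le> w" "w < m" for w using less.hyps[of w] that by simp
  show ?case
    unfolding lower_bound_def
  proof (intro allI impI)
    fix a b q r W
    assume *: "fort m a b W" "W \<noteq> {}" "m \<le> b - a + 1" "b - a + 1 - m = q * (m + 1) - r" "0 \<le> r" "r \<le> m"
    have "summary m (b - a + 2) (int (card W)) (corner m W a)"
      using fort_summary[OF less.prems lb *(1,2)] * less.prems by simp
    then have "summary m (b - a + 1 + 1) (int (card W)) (corner m W a)" by (simp add: algebra_simps)
    then show "target m (b - a + 1) q r \<le> int (card W)"
      using summary_target[OF _ less.prems *(3) *(4-6)] by blast
  qed
qed

section \<open>Forts that attain the bound\<close>

text \<open>The three reflections: two forts with matching end columns can be put together with an empty column in
  between, next to each other, or with the common column shared.\<close>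

lemma fort_glue_gap:
  assumes P: "fort m a (e - 1) P" and R: "fort m (e + 1) b R" and eq: "col P (e - 1) = col R (e + 1)"
    and e: "a \<le> e" "e \<le> b"
  shows "fort m a b (P \<union> R)"
proof (rule fortI)
  have "P \<subseteq> {a..b} \<times> {1..m}" using fort_grid[OF P] e by fastforce
  moreover have "R \<subseteq> {a..b} \<times> {1..m}" using fort_grid[OF R] e by fastforce
  ultimately show "P \<union> R \<subseteq> {a..b} \<times> {1..m}" by simp
  have L: "(x, y) \<in> P \<union> R \<longleftrightarrow> (x, y) \<in> P" if "x \<le> e" for x y using that fort_grid(1)[OF R, of x y] by auto
  have U: "(x, y) \<in> P \<union> R \<longleftrightarrow> (x, y) \<in> R" if "e \<le> x" for x y using that fort_grid(2)[OF P, of x y] by auto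
  fix i j assume ij: "a \<le> i" "i \<le> b" "1 \<le> j" "j \<le> m" "(i, j) \<notin> P \<union> R"
  consider "i < e" | "i = e" | "e < i" by linarith
  then show "balanced (P \<union> R) i j"
  proof cases
    case 1
    then have "(i, j) \<notin> P" "a \<le> i" "i \<le> e - 1" using ij by auto
    from fort_other[OF P this(2,3) ij(3,4) this(1)] show ?thesis
      unfolding balanced_def using L[of i] L[of "i - 1"] L[of "i + 1"] 1 by auto
  next
    case 2
    have "(e - 1, j) \<in> P \<longleftrightarrow> (e + 1, j) \<in> R" using eq by (auto simp: col_def)
    moreover have "(e - 1, j) \<in> P \<union> R \<longleftrightarrow> (e - 1, j) \<in> P" "(e + 1, j) \<in> P \<union> R \<longleftrightarrow> (e + 1, j) \<in> R"
      using L U by simp_all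
    moreover have "(e, y) \<notin> P \<union> R" for y using L[of e y] fort_grid(2)[OF P, of e y] by auto
    ultimately show ?thesis unfolding 2 balanced_def by blast
  next
    case 3
    then have "(i, j) \<notin> R" "e + 1 \<le> i" "i \<le> b" using ij by auto
    from fort_other[OF R this(2,3) ij(3,4) this(1)] show ?thesis
      unfolding balanced_def using U[of i] U[of "i - 1"] U[of "i + 1"] 3 by auto
  qed
qed

lemma fort_glue_adjacent:
  assumes P: "fort m a e P" and R: "fort m (e + 1) b R" and eq: "col P e = col R (e + 1)"
    and e: "a \<le> e" "e < b"
  shows "fort m a b (P \<union> R)"
proof (rule fortI)
  have "P \<subseteq> {a..b} \<times> {1..m}" using fort_grid[OF P] e by fastforce
  moreover have "R \<subseteq> {a..b} \<times> {1..m}" using fort_grid[OF R] e by fastforce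
  ultimately show "P \<union> R \<subseteq> {a..b} \<times> {1..m}" by simp
  have L: "(x, y) \<in> P \<union> R \<longleftrightarrow> (x, y) \<in> P" if "x \<le> e" for x y using that fort_grid(1)[OF R, of x y] by auto
  have U: "(x, y) \<in> P \<union> R \<longleftrightarrow> (x, y) \<in> R" if "e < x" for x y using that fort_grid(2)[OF P, of x y] by auto
  have PR: "(e, y) \<in> P \<longleftrightarrow> (e + 1, y) \<in> R" for y using eq by (auto simp: col_def)
  have out: "(e + 1, y) \<notin> P" "(e, y) \<notin> R" for y using fort_grid(2)[OF P] fort_grid(1)[OF R] by force+
  fix i j assume ij: "a \<le> i" "i \<le> b" "1 \<le> j" "j \<le> m" "(i, j) \<notin> P \<union> R"
  show "balanced (P \<union> R) i j"
  proof (cases "i \<le> e")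
    case True
    then have b: "(i, j) \<notin> P" using ij by auto
    have "(i + 1, j) \<in> P \<union> R \<longleftrightarrow> (i + 1, j) \<in> P"
      using L[of "i + 1" j] True PR[of j] out b U[of "e + 1" j] by (cases "i = e") auto
    with fort_other[OF P ij(1) True ij(3,4) b] show ?thesis
      unfolding balanced_def using L[of i] L[of "i - 1"] True by auto
  next
    case False
    then have b: "(i, j) \<notin> R" "e + 1 \<le> i" using ij by auto
    have "(i - 1, j) \<in> P \<union> R \<longleftrightarrow> (i - 1, j) \<in> R"
      using U[of "i - 1" j] False PR[of j] out b L[of e j] by (cases "i = e + 1") auto
    with fort_other[OF R b(2) ij(2-4) b(1)] show ?thesis
      unfolding balanced_def using U[of i] U[of "i + 1"] False by auto
  qed
qed

lemma fort_glue_shared: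
  assumes P: "fort m a e P" and R: "fort m e b R" and eq: "col P e = col R e"
    and e: "a \<le> e" "e \<le> b"
  shows "fort m a b (P \<union> R)"
proof (rule fortI)
  have "P \<subseteq> {a..b} \<times> {1..m}" using fort_grid[OF P] e by fastforce
  moreover have "R \<subseteq> {a..b} \<times> {1..m}" using fort_grid[OF R] e by fastforce
  ultimately show "P \<union> R \<subseteq> {a..b} \<times> {1..m}" by simp
  have PR: "(e, y) \<in> P \<longleftrightarrow> (e, y) \<in> R" for y using eq by (auto simp: col_def)
  have L: "(x, y) \<in> P \<union> R \<longleftrightarrow> (x, y) \<in> P" if "x \<le> e" for x y
    using that fort_grid(1)[OF R, of x y] PR[of y] by (cases "x = e") auto
  have U: "(x, y) \<in> P \<union> R \<longleftrightarrow> (x, y) \<in> R" if "e \<le> x" for x y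
    using that fort_grid(2)[OF P, of x y] PR[of y] by (cases "x = e") auto
  have out: "(e + 1, y) \<notin> P" "(e - 1, y) \<notin> R" for y using fort_grid(2)[OF P] fort_grid(1)[OF R] by force+
  fix i j assume ij: "a \<le> i" "i \<le> b" "1 \<le> j" "j \<le> m" "(i, j) \<notin> P \<union> R"
  consider "i < e" | "i = e" | "e < i" by linarith
  then show "balanced (P \<union> R) i j"
  proof cases
    case 1
    then have "(i, j) \<notin> P" "a \<le> i" "i \<le> e" using ij by auto
    from fort_other[OF P this(2,3) ij(3,4) this(1)] show ?thesis
      unfolding balanced_def using L[of i] L[of "i - 1"] L[of "i + 1"] 1 by auto
  next
    case 2
    then have b: "(e, j) \<notin> P" "(e, j) \<notin> R" using ij by auto
    show ?thesis
      unfolding 2 balanced_def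
      using fort_other[OF P e(1) order_refl ij(3,4) b(1)] fort_other[OF R order_refl e(2) ij(3,4) b(2)]
        L[of e] PR L[of "e - 1"] U[of "e + 1"] out by auto
  next
    case 3
    then have "(i, j) \<notin> R" "e \<le> i" "i \<le> b" using ij by auto
    from fort_other[OF R this(2,3) ij(3,4) this(1)] show ?thesis
      unfolding balanced_def using U[of i] U[of "i - 1"] U[of "i + 1"] 3 by auto
  qed
qed

definition shift :: "int \<Rightarrow> (int \<times> int) set \<Rightarrow> (int \<times> int) set" where
  "shift d W = {(i, j). (i - d, j) \<in> W}"

lemma in_shift [simp]: "(i, j) \<in> shift d W \<longleftrightarrow> (i - d, j) \<in> W"
  by (simp add: shift_def)

lemma col_shift: "col (shift d W) i = col W (i - d)"
  by (simp add: col_def)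

lemma card_shift: "card (shift d W) = card W"
proof -
  have "shift d W = (\<lambda>(i, j). (i + d, j)) ` W"
    by (auto simp: image_iff intro!: bexI[of _ "(_ - d, _)"])
  moreover have "inj_on (\<lambda>(i::int, j::int). (i + d, j)) W" by (auto simp: inj_on_def)
  ultimately show ?thesis using card_image by metis
qed

lemma card_flip: "card (flip m W) = card W"
proof -
  have "flip m W = (\<lambda>(i, j). (i, m + 1 - j)) ` W"
    by (auto simp: image_iff intro!: bexI[of _ "(_, m + 1 - _)"])
  moreover have "inj_on (\<lambda>(i::int, j::int). (i, m + 1 - j)) W" by (auto simp: inj_on_def)
  ultimately show ?thesis using card_image by metis
qed

lemma fort_shift:
  assumes "fort m a b W"
  shows "fort m (a + d) (b + d) (shift d W)"
proof (rule fortI)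
  show "shift d W \<subseteq> {a + d..b + d} \<times> {1..m}" using fort_grid[OF assms] by fastforce
  fix i j assume "a + d \<le> i" "i \<le> b + d" "1 \<le> j" "j \<le> m" "(i, j) \<notin> shift d W"
  then have *: "a \<le> i - d" "i - d \<le> b" "1 \<le> j" "j \<le> m" "(i - d, j) \<notin> W" by auto
  show "balanced (shift d W) i j"
    using fort_other[OF assms *] unfolding balanced_def by (simp add: algebra_simps)
qed

definition diagonal :: "int \<Rightarrow> (int \<times> int) set" where
  "diagonal m = {(i, j). i = j \<and> 1 \<le> j \<and> j \<le> m}"

lemma fort_diagonal: "fort m 1 m (diagonal m)"
proof (rule fortI)
  show "diagonal m \<subseteq> {1..m} \<times> {1..m}" by (auto simp: diagonal_def)
qed (auto simp: diagonal_def balanced_def)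

lemma col_diagonal: "1 \<le> i \<Longrightarrow> i \<le> m \<Longrightarrow> col (diagonal m) i = {i}"
  by (auto simp: diagonal_def)

lemma card_diagonal: "1 \<le> m \<Longrightarrow> int (card (diagonal m)) = m"
proof -
  assume "1 \<le> m"
  have "diagonal m = (\<lambda>i. (i, i)) ` {1..m}" by (auto simp: diagonal_def)
  moreover have "inj_on (\<lambda>i::int. (i, i)) {1..m}" by (auto simp: inj_on_def)
  ultimately show ?thesis using card_image \<open>1 \<le> m\<close> by fastforce
qed

text \<open>A fort with \<open>n\<close> columns and at most \<open>c\<close> vertices whose last column is the single top corner; strands that end in the
  bottom corner are flipped.\<close>

definition zigzag :: "int \<Rightarrow> int \<Rightarrow> int \<Rightarrow> bool" where
  "zigzag m n c \<longleftrightarrow> 1 \<le> n \<and> (\<exists>W. fort m 1 n W \<and> col W n = {m} \<and> int (card W) \<le> c)"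

lemma zigzag_start: "1 \<le> m \<Longrightarrow> zigzag m m m"
  unfolding zigzag_def using fort_diagonal[of m] col_diagonal[of m m] card_diagonal[of m]
  by (intro conjI exI[of _ "diagonal m"]) auto

lemma zigzag_attach:
  assumes z: "zigzag m n c" and R: "fort m 1 w R" "col R 1 = {1}" "2 \<le> w"
  shows "\<exists>W. fort m 1 (n + 1 + w) W \<and> col W (n + 1 + w) = col R w \<and> int (card W) \<le> c + int (card R)"
    and "\<exists>W. fort m 1 (n + w) W \<and> col W (n + w) = col R w \<and> int (card W) \<le> c + int (card R)"
    and "\<exists>W. fort m 1 (n + w - 1) W \<and> col W (n + w - 1) = col R w \<and> int (card W) \<le> c + int (card R) - 1"
proof -
  obtain Z where Z: "1 \<le> n" "fort m 1 n Z" "col Z n = {m}" "int (card Z) \<le> c" using z unfolding zigzag_def by blast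
  let ?P = "flip m Z"
  have P: "fort m 1 n ?P" "col ?P n = {1}" "int (card ?P) \<le> c"
    using fort_flip[OF Z(2)] Z(3,4) by (simp_all add: col_flip card_flip)
  have far: "col ?P i = {}" if "n < i" for i using col_outside[OF P(1)] that by simp
  have un: "int (card (?P \<union> shift d R)) \<le> c + int (card R)" for d
    using card_Un_le[of ?P "shift d R"] P(3) by (simp add: card_shift)
  have colU: "col (A \<union> B) i = col A i \<union> col B i" for A B :: "(int \<times> int) set" and i by (auto simp: col_def)
  have S1: "fort m (n + 1 + 1) (n + 1 + w) (shift (n + 1) R)"
    using fort_shift[OF R(1), of "n + 1"] by (simp add: algebra_simps)
  have P1: "fort m 1 (n + 1 - 1) ?P" using P(1) by simp
  have "fort m 1 (n + 1 + w) (?P \<union> shift (n + 1) R)"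
    by (rule fort_glue_gap[OF P1 S1]) (use P R Z(1) in \<open>simp_all add: col_shift\<close>)
  then show "\<exists>W. fort m 1 (n + 1 + w) W \<and> col W (n + 1 + w) = col R w \<and> int (card W) \<le> c + int (card R)"
    using un far[of "n + 1 + w"] R(3) by (intro exI[of _ "?P \<union> shift (n + 1) R"]) (simp add: colU col_shift)
  have S2: "fort m (n + 1) (n + w) (shift n R)"
    using fort_shift[OF R(1), of n] by (simp add: algebra_simps)
  have "fort m 1 (n + w) (?P \<union> shift n R)"
    by (rule fort_glue_adjacent[OF P(1) S2]) (use P R Z(1) in \<open>simp_all add: col_shift\<close>)
  then show "\<exists>W. fort m 1 (n + w) W \<and> col W (n + w) = col R w \<and> int (card W) \<le> c + int (card R)"
    using un far[of "n + w"] R(3) by (intro exI[of _ "?P \<union> shift n R"]) (simp add: colU col_shift)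
  have S: "fort m n (n + w - 1) (shift (n - 1) R)"
    using fort_shift[OF R(1), of "n - 1"] by (simp add: algebra_simps)
  have "fort m 1 (n + w - 1) (?P \<union> shift (n - 1) R)"
    by (rule fort_glue_shared[OF P(1) S]) (use P R Z(1) in \<open>simp_all add: col_shift\<close>)
  moreover have "int (card (?P \<union> shift (n - 1) R)) \<le> c + int (card R) - 1"
  proof -
    have "(n, 1) \<in> ?P" "(1, 1) \<in> R" using col_single_iff[OF P(2)] col_single_iff[OF R(2)] by blast+
    then have "(n, 1) \<in> ?P \<inter> shift (n - 1) R" by simp
    moreover have "finite (?P \<inter> shift (n - 1) R)" using fort_finite[OF P(1)] by simp
    ultimately have "0 < card (?P \<inter> shift (n - 1) R)" using card_gt_0_iff by blast
    then show ?thesis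
      using card_Un_Int[OF fort_finite[OF P(1)] fort_finite[OF S]] P(3) by (simp add: card_shift)
  qed
  ultimately show "\<exists>W. fort m 1 (n + w - 1) W \<and> col W (n + w - 1) = col R w \<and> int (card W) \<le> c + int (card R) - 1"
    using far[of "n + w - 1"] R(3) by (intro exI[of _ "?P \<union> shift (n - 1) R"]) (simp add: colU col_shift)
qed

lemma zigzag_bounce:
  assumes z: "zigzag m n c" and m: "2 \<le> m"
  shows "zigzag m (n + (m + 1)) (c + m)" "zigzag m (n + m) (c + m)" "zigzag m (n + (m - 1)) (c + (m - 1))"
proof -
  note A = zigzag_attach[OF z fort_diagonal col_diagonal[of 1 m] m]
  have n: "1 \<le> n" using z by (simp add: zigzag_def)
  show "zigzag m (n + (m + 1)) (c + m)" "zigzag m (n + m) (c + m)" "zigzag m (n + (m - 1)) (c + (m - 1))"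
    unfolding zigzag_def using A n m col_diagonal[of m m] card_diagonal[of m] by (auto simp: algebra_simps)
qed

lemma zigzag_exists:
  assumes m: "2 \<le> m"
  shows "zigzag m (m + int A * (m + 1) + int B * m + int C * (m - 1)) (m + int A * m + int B * m + int C * (m - 1))"
proof (induction C)
  case 0
  show ?case
  proof (induction B)
    case 0
    show ?case
    proof (induction A)
      case 0 then show ?case using zigzag_start m by simp
    next
      case (Suc A) then show ?case using zigzag_bounce(1)[OF Suc m] by (simp add: algebra_simps)
    qed
  next
    case (Suc B) then show ?case using zigzag_bounce(2)[OF Suc m] by (simp add: algebra_simps)
  qed
next
  case (Suc C) then show ?case using zigzag_bounce(3)[OF Suc m] by (simp add: algebra_simps)
qed

text \<open>A diagonal from the bottom corner to \<open>(k, k)\<close>, where it forks into the rectangle with corners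
  \<open>(k, k)\<close>, \<open>(m, m)\<close>, \<open>(k + m - 1, m - k + 1)\<close> and \<open>(2 k - 1, 1)\<close>.\<close>

definition lasso :: "int \<Rightarrow> int \<Rightarrow> (int \<times> int) set" where
  "lasso m k = {(i, j). i = j \<and> 1 \<le> i \<and> i \<le> m \<or> i + j = 2 * m \<and> m \<le> i \<and> i \<le> m + k - 1 \<or>
     i + j = 2 * k \<and> k \<le> i \<and> i \<le> 2 * k - 1 \<or> i - j = 2 * k - 2 \<and> 2 * k - 1 \<le> i \<and> i \<le> k + m - 1}"

lemma in_lasso: "(i, j) \<in> lasso m k \<longleftrightarrow> i = j \<and> 1 \<le> i \<and> i \<le> m \<or> i + j = 2 * m \<and> m \<le> i \<and> i \<le> m + k - 1 \<or>
     i + j = 2 * k \<and> k \<le> i \<and> i \<le> 2 * k - 1 \<or> i - j = 2 * k - 2 \<and> 2 * k - 1 \<le> i \<and> i \<le> k + m - 1"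
  by (simp add: lasso_def)

lemma fort_lasso:
  assumes "1 < k" "k < m"
  shows "fort m 1 (k + m - 1) (lasso m k)"
proof (rule fortI)
  show "lasso m k \<subseteq> {1..k + m - 1} \<times> {1..m}" using assms by (auto simp: lasso_def)
  fix i j assume ij: "1 \<le> i" "i \<le> k + m - 1" "1 \<le> j" "j \<le> m"
  have "(i - 1, j) \<in> lasso m k \<Longrightarrow> (i + 1, j) \<in> lasso m k \<or> (i, j - 1) \<in> lasso m k \<or> (i, j + 1) \<in> lasso m k"
    using assms ij unfolding in_lasso by (smt (verit))
  moreover have "(i + 1, j) \<in> lasso m k \<Longrightarrow> (i - 1, j) \<in> lasso m k \<or> (i, j - 1) \<in> lasso m k \<or> (i, j + 1) \<in> lasso m k"
    using assms ij unfolding in_lasso by (smt (z3))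
  moreover have "(i, j - 1) \<in> lasso m k \<Longrightarrow> (i - 1, j) \<in> lasso m k \<or> (i + 1, j) \<in> lasso m k \<or> (i, j + 1) \<in> lasso m k"
    using assms ij unfolding in_lasso by (smt (z3))
  moreover have "(i, j + 1) \<in> lasso m k \<Longrightarrow> (i - 1, j) \<in> lasso m k \<or> (i + 1, j) \<in> lasso m k \<or> (i, j - 1) \<in> lasso m k"
    using assms ij unfolding in_lasso by (smt (verit))
  ultimately show "balanced (lasso m k) i j"
    unfolding balanced_def by blast
qed

lemma col_lasso: "1 < k \<Longrightarrow> k < m \<Longrightarrow> col (lasso m k) 1 = {1}"
  by (auto simp: lasso_def)

lemma card_lasso:
  assumes "1 < k" "k < m"
  shows "int (card (lasso m k)) \<le> 2 * m + k - 3"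
proof -
  let ?A = "(\<lambda>i. (i, i)) ` {1..m}" and ?B = "(\<lambda>i. (i, 2 * m - i)) ` {m+1..m+k-1}"
  let ?C = "(\<lambda>i. (i, 2 * k - i)) ` {k+1..2*k-1}" and ?D = "(\<lambda>i. (i, i - 2 * k + 2)) ` {2*k..k+m-2}"
  have "lasso m k \<subseteq> ?A \<union> ?B \<union> ?C \<union> ?D"
  proof
    fix p assume "p \<in> lasso m k"
    moreover obtain i j where p: "p = (i, j)" by force
    ultimately have "(i, j) \<in> lasso m k" by simp
    then have "i = j \<and> 1 \<le> i \<and> i \<le> m \<or> j = 2 * m - i \<and> m + 1 \<le> i \<and> i \<le> m + k - 1 \<or>
        j = 2 * k - i \<and> k + 1 \<le> i \<and> i \<le> 2 * k - 1 \<or> j = i - 2 * k + 2 \<and> 2 * k \<le> i \<and> i \<le> k + m - 2"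
      using assms unfolding in_lasso by (smt (verit))
    then have "i = j \<and> i \<in> {1..m} \<or> j = 2 * m - i \<and> i \<in> {m+1..m+k-1} \<or> j = 2 * k - i \<and> i \<in> {k+1..2*k-1} \<or>
        j = i - 2 * k + 2 \<and> i \<in> {2*k..k+m-2}"
      unfolding atLeastAtMost_iff .
    then show "p \<in> ?A \<union> ?B \<union> ?C \<union> ?D" unfolding p by blast
  qed
  then have "card (lasso m k) \<le> card (?A \<union> ?B \<union> ?C \<union> ?D)" by (intro card_mono) auto
  also have "\<dots> \<le> card ?A + card ?B + card ?C + card ?D"
    using card_Un_le[of "?A \<union> ?B \<union> ?C" ?D] card_Un_le[of "?A \<union> ?B" ?C] card_Un_le[of ?A ?B] by linarith
  also have "\<dots> \<le> card {1..m} + card {m+1..m+k-1} + card {k+1..2*k-1} + card {2*k..k+m-2}"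
    by (intro add_mono card_image_le) auto
  finally show ?thesis using assms by simp
qed

text \<open>For \<open>r \<le> 2 q\<close>: of the \<open>q\<close> reflections, \<open>C\<close> share a column, \<open>B \<le> 1\<close> are without empty column, and \<open>A\<close> have
  one; then \<open>A - C = q - r\<close>. For \<open>r > 2 q\<close>: \<open>q - 1\<close> empty columns, and a lasso at the end, whose parameter \<open>k\<close>
  is chosen to fill the grid.\<close>

lemma small_fort_exists:
  assumes m: "2 \<le> m" "m \<le> n" and n: "n - m = q * (m + 1) - r" and r: "0 \<le> r" "r \<le> m"
  shows "\<exists>W. fort m 1 n W \<and> W \<noteq> {} \<and> int (card W) \<le> target m n q r"
proof -
  have ne: "W \<noteq> {}" if "col W i = {x}" for W i x using that by (auto simp: col_def)
  have "0 \<le> q * (m + 1)" using n m r by linarith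
  then have q0: "0 \<le> q" using m by (simp add: zero_le_mult_iff)
  show ?thesis
  proof (cases "r \<le> 2 * q")
    case True
    define A where "A = nat (q - (r + 1) div 2)"
    define B where "B = nat ((r + 1) div 2 - r div 2)"
    define C where "C = nat (r div 2)"
    have ABC: "int A = q - (r + 1) div 2" "int B = (r + 1) div 2 - r div 2" "int C = r div 2"
      using True r unfolding A_def B_def C_def by auto
    have half: "(r + 1) div 2 + r div 2 = r" by presburger
    have sum: "int A + int B + int C = q" "int A - int C = q - r" using ABC half by linarith+
    have "int A * (m + 1) + int B * m + int C * (m - 1) = (int A + int B + int C) * m + (int A - int C)"
      by (simp add: algebra_simps)
    then have w: "m + int A * (m + 1) + int B * m + int C * (m - 1) = n"
      unfolding sum using n by (simp add: algebra_simps)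
    then have "m + int A * m + int B * m + int C * (m - 1) = n - int A" by (simp add: algebra_simps)
    then have c: "m + int A * m + int B * m + int C * (m - 1) = target m n q r"
      using True ABC(1) by (simp add: target_def)
    show ?thesis using zigzag_exists[OF m(1), of A B C] ne unfolding w c zigzag_def by blast
  next
    case False
    define k where "k = m + 2 - r"
    have q1: "1 \<le> q"
    proof (rule ccontr)
      assume "\<not> 1 \<le> q"
      then have "q = 0" using q0 by simp
      then show False using n m False by simp
    qed
    have k: "1 < k" "k < m" using False q1 r unfolding k_def by auto
    note L = fort_lasso[OF k] col_lasso[OF k] card_lasso[OF k]
    show ?thesis
    proof (cases "q = 1")
      case True
      then have "k + m - 1 = n" "2 * m + k - 3 = target m n q r"
        using n False unfolding k_def target_def by (auto simp: algebra_simps)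
      then show ?thesis using L ne[OF L(2)] by (intro exI[of _ "lasso m k"]) simp
    next
      case False': False
      define A where "A = nat (q - 2)"
      have A: "int A = q - 2" using q1 False' by (simp add: A_def)
      have z: "zigzag m (m + int A * (m + 1)) (m + int A * m)" using zigzag_exists[OF m(1), of A 0 0] by simp
      have w: "m + int A * (m + 1) + 1 + (k + m - 1) = n" unfolding A k_def using n by (simp add: algebra_simps)
      have c: "m + int A * m + (2 * m + k - 3) = target m n q r"
        unfolding A k_def target_def using n False by (simp add: algebra_simps)
      have w2: "2 \<le> k + m - 1" using k by simp
      obtain W where W: "fort m 1 n W" "col W n = col (lasso m k) (k + m - 1)"
        "int (card W) \<le> m + int A * m + int (card (lasso m k))"
        using zigzag_attach(1)[OF z L(1,2) w2] unfolding w by blast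
      have "col (lasso m k) (k + m - 1) \<noteq> {}"
        using last_col_nonempty[OF L(1) ne[OF L(2)]] k by simp
      then have "W \<noteq> {}" using W(2) by (auto simp: col_def)
      moreover have "int (card W) \<le> target m n q r" using W(3) L(3) c by linarith
      ultimately show ?thesis using W(1) by blast
    qed
  qed
qed

section \<open>Zero blocking sets of grids\<close>

lemma grid_simps:
  "pverts (grid_graph m n) = {1..n} \<times> {1..m}"
  "((i, j), (x, y)) \<in> parcs (grid_graph m n) \<longleftrightarrow>
     1 \<le> i \<and> i \<le> n \<and> 1 \<le> j \<and> j \<le> m \<and> 1 \<le> x \<and> x \<le> n \<and> 1 \<le> y \<and> y \<le> m \<and> \<bar>x - i\<bar> + \<bar>y - j\<bar> = 1"
  by (auto simp: grid_graph_def grid_vertices_def abs_minus_commute)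

lemma stalled_iff_fort:
  assumes "W \<subseteq> {1..n} \<times> {1..m}"
  shows "(\<nexists>C. force_step (grid_graph m n) (pverts (grid_graph m n) - W) C) \<longleftrightarrow> fort m 1 n W"
proof -
  let ?G = "grid_graph m n"
  have nb: "{v \<in> pverts ?G - (pverts ?G - W). ((i, j), v) \<in> parcs ?G} = {(x, y) \<in> W. \<bar>x - i\<bar> + \<bar>y - j\<bar> = 1}"
    if "1 \<le> i" "i \<le> n" "1 \<le> j" "j \<le> m" for i j
    using that assms by (auto simp: grid_simps)
  have "(\<exists>C. force_step ?G (pverts ?G - W) C) \<longleftrightarrow>
    (\<exists>i j. 1 \<le> i \<and> i \<le> n \<and> 1 \<le> j \<and> j \<le> m \<and> (i, j) \<notin> W \<and> (\<exists>w. {(x, y) \<in> W. \<bar>x - i\<bar> + \<bar>y - j\<bar> = 1} = {w}))"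
    (is "?l \<longleftrightarrow> ?r")
  proof
    assume ?l
    then obtain u w where u: "u \<in> pverts ?G - W" "{v \<in> pverts ?G - (pverts ?G - W). (u, v) \<in> parcs ?G} = {w}"
      unfolding force_step_def by blast
    obtain i j where ij: "u = (i, j)" by (rule prod.exhaust)
    have g: "1 \<le> i" "i \<le> n" "1 \<le> j" "j \<le> m" "(i, j) \<notin> W"
      using u(1) unfolding ij grid_simps(1) by auto
    have "{(x, y) \<in> W. \<bar>x - i\<bar> + \<bar>y - j\<bar> = 1} = {w}" using u(2) nb[OF g(1-4)] unfolding ij by simp
    then show ?r using g by blast
  next
    assume ?r
    then obtain i j w where ij: "1 \<le> i" "i \<le> n" "1 \<le> j" "j \<le> m" "(i, j) \<notin> W"
      "{(x, y) \<in> W. \<bar>x - i\<bar> + \<bar>y - j\<bar> = 1} = {w}" by blast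
    have "(i, j) \<in> pverts ?G - W" using ij by (simp add: grid_simps(1))
    moreover have "{v \<in> pverts ?G - (pverts ?G - W). ((i, j), v) \<in> parcs ?G} = {w}"
      unfolding nb[OF ij(1-4)] by (fact ij(6))
    ultimately show ?l unfolding force_step_def by (intro exI[of _ "insert w (pverts ?G - W)"] bexI[of _ "(i, j)"] exI[of _ w]) auto
  qed
  moreover have "fort m 1 n W \<longleftrightarrow> \<not> ?r"
  proof -
    define Q where "Q i j \<longleftrightarrow> (\<forall>x y. (x, y) \<in> W \<and> \<bar>x - i\<bar> + \<bar>y - j\<bar> = 1 \<longrightarrow>
      (\<exists>x' y'. (x', y') \<in> W \<and> \<bar>x' - i\<bar> + \<bar>y' - j\<bar> = 1 \<and> (x', y') \<noteq> (x, y)))" for i j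
    have Q: "(\<exists>w. {(x, y) \<in> W. \<bar>x - i\<bar> + \<bar>y - j\<bar> = 1} = {w}) \<longleftrightarrow> \<not> Q i j" for i j
    proof -
      define S where "S = {(x, y) \<in> W. \<bar>x - i\<bar> + \<bar>y - j\<bar> = 1}"
      have S: "(x, y) \<in> S \<longleftrightarrow> (x, y) \<in> W \<and> \<bar>x - i\<bar> + \<bar>y - j\<bar> = 1" for x y by (simp add: S_def)
      have "(\<forall>p\<in>S. \<exists>p'\<in>S. p' \<noteq> p) \<longleftrightarrow> Q i j"
        unfolding Q_def Ball_def Bex_def split_paired_All split_paired_Ex S conj_assoc by (rule refl)
      moreover have "(\<exists>w. S = {w}) \<longleftrightarrow> \<not> (\<forall>p\<in>S. \<exists>p'\<in>S. p' \<noteq> p)" by blast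
      ultimately show ?thesis unfolding S_def[symmetric] by simp
    qed
    have "fort m 1 n W \<longleftrightarrow> (\<forall>i j. 1 \<le> i \<and> i \<le> n \<and> 1 \<le> j \<and> j \<le> m \<and> (i, j) \<notin> W \<longrightarrow> Q i j)"
      using assms unfolding fort_def Q_def by simp
    then show ?thesis unfolding Q by blast
  qed
  ultimately show ?thesis by blast
qed

text \<open>Every force decreases the number of white vertices.\<close>

lemma forcing_terminates:
  assumes "finite (pverts G)"
  shows "\<exists>C. (force_step G)\<^sup>*\<^sup>* B C \<and> (\<nexists>C'. force_step G C C')"
proof (induction "card (pverts G - B)" arbitrary: B rule: less_induct)
  case less
  show ?case
  proof (cases "\<exists>B'. force_step G B B'")
    case True
    then obtain B' where B': "force_step G B B'" by blast
    then obtain u w where "{v \<in> pverts G - B. (u, v) \<in> parcs G} = {w}" "B' = insert w B"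
      unfolding force_step_def by blast
    then have "pverts G - B' \<subset> pverts G - B" by blast
    then have "card (pverts G - B') < card (pverts G - B)" using assms by (intro psubset_card_mono) auto
    from less[OF this] B' show ?thesis by (meson converse_rtranclp_into_rtranclp)
  qed blast
qed

lemma fort_zero_blocking:
  assumes "fort m 1 n W" "W \<noteq> {}"
  shows "zero_blocking_set (grid_graph m n) W"
proof -
  let ?V = "pverts (grid_graph m n)"
  have sub: "W \<subseteq> {1..n} \<times> {1..m}" using assms(1) by (simp add: fort_def)
  have "\<nexists>C. force_step (grid_graph m n) (?V - W) C" using stalled_iff_fort[OF sub] assms(1) by blast
  then have "zero_forcing_set (grid_graph m n) (?V - W) \<longleftrightarrow> ?V - W = ?V"
    by (intro zero_forcing_set_iff_final) auto
  then show ?thesis using sub assms(2) unfolding zero_blocking_set_def grid_simps(1) by blast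
qed

text \<open>The vertices that remain white in a final coloring.\<close>

lemma zero_blocking_contains_fort:
  assumes "zero_blocking_set (grid_graph m n) W"
  obtains F where "F \<subseteq> W" "F \<noteq> {}" "fort m 1 n F"
proof -
  let ?G = "grid_graph m n"
  let ?V = "pverts ?G"
  have W: "W \<subseteq> ?V" "\<not> zero_forcing_set ?G (?V - W)" using assms by (auto simp: zero_blocking_set_def)
  have "finite ?V" by (simp add: grid_simps(1))
  then obtain C where C: "(force_step ?G)\<^sup>*\<^sup>* (?V - W) C" "\<nexists>C'. force_step ?G C C'"
    using forcing_terminates by blast
  have CV: "C \<subseteq> ?V" using force_steps_subset_verts[OF C(1)] by blast
  have "C \<noteq> ?V" using zero_forcing_set_iff_final[OF _ C] W(2) by blast
  moreover have BC: "?V - W \<subseteq> C"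
    using C(1) by (induction rule: rtranclp_induct) (auto simp: force_step_def)
  moreover have "?V - (?V - C) = C" using CV by blast
  then have "fort m 1 n (?V - C)" using stalled_iff_fort[of "?V - C" n m] C(2) by (simp add: grid_simps(1))
  ultimately show thesis using that[of "?V - C"] CV by blast
qed

lemma zero_blocking_number_grid:
  assumes m: "2 \<le> m" "m \<le> n" and n: "n - m = q * (m + 1) - r" and r: "0 \<le> r" "r \<le> m"
  shows "int (zero_blocking_number (grid_graph m n)) = target m n q r"
proof -
  have lower: "target m n q r \<le> int (card W)" if Z: "zero_blocking_set (grid_graph m n) W" for W
  proof -
    obtain F where F: "F \<subseteq> W" "F \<noteq> {}" "fort m 1 n F" using Z by (rule zero_blocking_contains_fort)
    have "finite W" using Z finite_subset[of W "{1..n} \<times> {1..m}"]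
      by (simp add: zero_blocking_set_def grid_simps(1))
    then have "card F \<le> card W" using F(1) card_mono by blast
    moreover have "target m n q r \<le> int (card F)"
      using lower_bound_all[of m, unfolded lower_bound_def, rule_format, OF _ F(3,2), of q r] m n r by simp
    ultimately show ?thesis by linarith
  qed
  obtain W where W: "fort m 1 n W" "W \<noteq> {}" "int (card W) \<le> target m n q r"
    using small_fort_exists[OF m n r] by blast
  have Z: "zero_blocking_set (grid_graph m n) W" using fort_zero_blocking[OF W(1,2)] .
  have "zero_blocking_number (grid_graph m n) = card W"
    unfolding zero_blocking_number_def
  proof (rule Least_equality)
    show "\<exists>V. zero_blocking_set (grid_graph m n) V \<and> card V = card W" using Z by blast
    show "card W \<le> k" if "\<exists>V. zero_blocking_set (grid_graph m n) V \<and> card V = k" for k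
      using that lower W(3) by force
  qed
  then show ?thesis using lower[OF Z] W(3) by simp
qed

theorem theorem9:
  fixes m n q r :: int
  assumes "2 \<le> m" and "m \<le> n"
    and "n - m = q * (m + 1) - r"
    and "0 \<le> r" and "r \<le> m"
  shows "(r \<le> 2 * q \<longrightarrow>
            int (zero_blocking_number (grid_graph m n)) = n - q + \<lceil>real_of_int r / 2\<rceil>) \<and>
         (r > 2 * q \<longrightarrow>
            int (zero_blocking_number (grid_graph m n)) = n - q + m - 1)"
proof -
  have "\<lceil>real_of_int r / 2\<rceil> = (r + 1) div 2"
    by (rule ceiling_unique) linarith+
  then show ?thesis
    using zero_blocking_number_grid[OF assms] by (simp add: target_def)
qed

end
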